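(* Suppose that $M$ is a bounded, connected, embedded complex submanifold of $\mathbb{C}^d$ that satisfies the weak visibility property and is taut. Let $F:M\to M$ be a holomorphic map, and let $F^\nu$ denote its $\nu$-th iterate. Then exactly one of the following holds: (1) for every $z\in M$, $\{F^\nu(z):\nu\in\mathbb{Z}_+\}$ is a relatively compact subset of $M$; (2) there exists $\xi\in\partial M$ such that, for every $z\in M$, $\lim_{\nu\to\infty}F^\nu(z)=\xi$, this convergence being uniform on the compact subsets of $M$.
   Context: $\partial M:=\overline M\setminus M$, with $\overline M$ the closure of $M$ in $\mathbb{C}^d$. $\mathbb{D}$ is the open unit disk in $\mathbb{C}$ and $\mathbb{Z}_+$ is the set of positive integers. $\mathsf{k}_M$ is the Kobayashi distance and $\kappa_M(z;v)=\inf\{t>0:\exists\,\phi:\mathbb{D}\to M \text{ holomorphic},\ \phi(0)=z,\ t\phi'(0)=v\}$ ($z\in M$, $v\in T^{(1,0)}_zM$) is the Kobayashi--Royden metric of $M$. $M$ is taut if every sequence of holomorphic maps $\mathbb{D}\to M$ has a subsequence that either converges uniformly on compact subsets to a holomorphic map $\mathbb{D}\to M$ or is compactly divergent. For $\kappa>0$ and an interval $I\subset\mathbb{R}$, a $(1,\kappa)$-almost-geodesic is an absolutely continuous curve $\sigma:I\to M$ such that $|t-s|-\kappa\leq\mathsf{k}_M(\sigma(t),\sigma(s))\leq|t-s|+\kappa$ for all $s,t\in I$ and $\kappa_M(\sigma(t);\sigma'(t))\leq1$ for almost every $t\in I$. $M$ has the visibility property with respect to $(1,\kappa)$-almost-geodesics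 if any two distinct points of $M$ can be joined by a $(1,\kappa)$-almost-geodesic and, for every pair of points $p\neq q$ in $\partial M$, there exist $\mathbb{C}^d$-neighbourhoods $V$ of $p$ and $W$ of $q$ with $\overline V\cap\overline W=\emptyset$ and a compact set $K\subset M$ such that every $(1,\kappa)$-almost-geodesic in $M$ with initial point in $V$ and terminal point in $W$ intersects $K$. $M$ satisfies the weak visibility property (is a weak visibility submanifold) if this holds for all $\kappa>0$. *)

theory Defs
  imports "HOL-Complex_Analysis.Complex_Analysis"
begin

section \<open>Holomorphic maps and complex submanifolds\<close>

text \<open>
  The derivative is given by a complex matrix, i.e. the real Frechet derivative is complex-linear.
\<close>

definition holomorphic_map_on :: "(complex^'n) set \<Rightarrow> (complex^'n \<Rightarrow> complex^'m) \<Rightarrow> bool" where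
  "holomorphic_map_on U f \<longleftrightarrow>
     (\<forall>z\<in>U. \<exists>A :: complex^'n^'m. (f has_derivative (\<lambda>v. A *v v)) (at z))"

text \<open>
  Submanifolds are described by slice charts: near each of its points, \<open>M\<close> is carried by a
  biholomorphism between open subsets of the ambient space onto a piece of the coordinate subspace
  \<open>{w. \<forall>i\<in>J. w $ i = 0}\<close>. Since \<open>J\<close> does not depend on the point, \<open>M\<close> is of pure dimension
  \<open>card (- J)\<close>; after permuting coordinates this is no further restriction. A submanifold need not
  be a closed subset of the ambient space.
\<close>

definition embedded_complex_submanifold :: "(complex^'d) set \<Rightarrow> bool" where
  "embedded_complex_submanifold M \<longleftrightarrow>
     (\<exists>J :: 'd set. \<forall>p\<in>M. \<exists>U V \<Phi> \<Psi>.
        open U \<and> p \<in> U \<and> open V \<and>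
        homeomorphism U V \<Phi> \<Psi> \<and> holomorphic_map_on U \<Phi> \<and> holomorphic_map_on V \<Psi> \<and>
        \<Phi> ` (U \<inter> M) = V \<inter> {w. \<forall>i\<in>J. w $ i = 0})"

text \<open>
  A map on an embedded submanifold is holomorphic iff it is locally the restriction of a
  holomorphic map on an open subset of the ambient space.
\<close>

definition holomorphic_on_submanifold ::
    "(complex^'d) set \<Rightarrow> (complex^'d \<Rightarrow> complex^'m) \<Rightarrow> bool" where
  "holomorphic_on_submanifold M F \<longleftrightarrow>
     (\<forall>p\<in>M. \<exists>U G. open U \<and> p \<in> U \<and> holomorphic_map_on U G \<and> (\<forall>z\<in>U \<inter> M. F z = G z))"

definition submanifold_boundary :: "(complex^'d) set \<Rightarrow> (complex^'d) set" where
  "submanifold_boundary M = closure M - M"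

text \<open>For \<open>S \<subseteq> M\<close>, the closure of \<open>S\<close> in the subspace \<open>M\<close> is \<open>M \<inter> closure S\<close>.\<close>

definition relatively_compact_in :: "'a::topological_space set \<Rightarrow> 'a set \<Rightarrow> bool" where
  "relatively_compact_in M S \<longleftrightarrow> S \<subseteq> M \<and> compact (M \<inter> closure S)"


section \<open>Analytic discs and tautness\<close>

definition analytic_disc :: "(complex^'d) set \<Rightarrow> (complex \<Rightarrow> complex^'d) \<Rightarrow> bool" where
  "analytic_disc M \<phi> \<longleftrightarrow>
     (\<forall>i. (\<lambda>\<zeta>. \<phi> \<zeta> $ i) holomorphic_on ball 0 1) \<and> \<phi> ` ball 0 1 \<subseteq> M"

definition compactly_divergent :: "(complex^'d) set \<Rightarrow> (nat \<Rightarrow> complex \<Rightarrow> complex^'d) \<Rightarrow> bool" where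
  "compactly_divergent M f \<longleftrightarrow>
     (\<forall>K L. compact K \<and> K \<subseteq> ball 0 1 \<and> compact L \<and> L \<subseteq> M \<longrightarrow>
        (\<forall>\<^sub>F n in sequentially. f n ` K \<inter> L = {}))"

definition taut :: "(complex^'d) set \<Rightarrow> bool" where
  "taut M \<longleftrightarrow>
     (\<forall>f. (\<forall>n. analytic_disc M (f n)) \<longrightarrow>
        (\<exists>r :: nat \<Rightarrow> nat. strict_mono r \<and>
           ((\<exists>g. analytic_disc M g \<and>
               (\<forall>K. compact K \<and> K \<subseteq> ball 0 1 \<longrightarrow> uniform_limit K (f \<circ> r) g sequentially)) \<or>
            compactly_divergent M (f \<circ> r))))"


section \<open>The Kobayashi distance and the Kobayashi--Royden metric\<close>

text \<open>
  The Poincare distance is normalised to have infinitesimal form \<open>\<bar>d\<zeta>\<bar> / (1 - \<bar>\<zeta>\<bar>\<^sup>2)\<close>, which is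
  the Kobayashi--Royden metric of the unit disc.
\<close>

definition poincare_dist :: "complex \<Rightarrow> complex \<Rightarrow> real" where
  "poincare_dist \<zeta> \<omega> = artanh (cmod ((\<zeta> - \<omega>) / (1 - cnj \<omega> * \<zeta>)))"

text \<open>
  Both infima are taken in the extended reals, so that the infimum of the empty set is \<open>\<infinity>\<close>.
  This is the value of the distance for points not joined by a chain of discs (which does not
  happen in a connected submanifold) and of the metric for vectors that are not tangent to \<open>M\<close>.
\<close>

definition kobayashi_dist :: "(complex^'d) set \<Rightarrow> complex^'d \<Rightarrow> complex^'d \<Rightarrow> ereal" where
  "kobayashi_dist M z w =
     Inf {ereal (\<Sum>j<n. poincare_dist (\<zeta> j) (\<omega> j)) | (n :: nat) p \<phi> \<zeta> \<omega>.
            p 0 = z \<and> p n = w \<and>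
            (\<forall>j<n. analytic_disc M (\<phi> j) \<and> \<zeta> j \<in> ball 0 1 \<and> \<omega> j \<in> ball 0 1 \<and>
                   \<phi> j (\<zeta> j) = p j \<and> \<phi> j (\<omega> j) = p (Suc j))}"

text \<open>
  The holomorphic tangent space at a point of \<open>M\<close> is viewed as a subspace of the ambient space.
\<close>

definition kobayashi_metric :: "(complex^'d) set \<Rightarrow> complex^'d \<Rightarrow> complex^'d \<Rightarrow> ereal" where
  "kobayashi_metric M z v =
     Inf {ereal t | t. 0 < t \<and>
            (\<exists>\<phi>. analytic_disc M \<phi> \<and> \<phi> 0 = z \<and> t *\<^sub>R (\<chi> i. deriv (\<lambda>\<zeta>. \<phi> \<zeta> $ i) 0) = v)}"


section \<open>Almost-geodesics and visibility\<close>

text \<open>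
  On a non-compact interval, absolute continuity means absolute continuity on every compact
  subinterval. A pair \<open>(s, t)\<close> in \<open>P\<close> stands for the interval from \<open>s\<close> to \<open>t\<close>.
\<close>

definition absolutely_continuous_curve :: "real set \<Rightarrow> (real \<Rightarrow> 'a::real_normed_vector) \<Rightarrow> bool" where
  "absolutely_continuous_curve I \<sigma> \<longleftrightarrow>
     (\<forall>a b. {a..b} \<subseteq> I \<longrightarrow>
        (\<forall>\<epsilon>>0. \<exists>\<delta>>0. \<forall>P.
           finite P \<and> (\<forall>(s, t)\<in>P. a \<le> s \<and> s \<le> t \<and> t \<le> b) \<and>
           pairwise (\<lambda>(s, t) (s', t'). {s<..<t} \<inter> {s'<..<t'} = {}) P \<and>
           (\<Sum>(s, t)\<in>P. t - s) < \<delta> \<longrightarrow>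
           (\<Sum>(s, t)\<in>P. norm (\<sigma> t - \<sigma> s)) < \<epsilon>))"

definition almost_geodesic ::
    "(complex^'d) set \<Rightarrow> real \<Rightarrow> real set \<Rightarrow> (real \<Rightarrow> complex^'d) \<Rightarrow> bool" where
  "almost_geodesic M \<kappa> I \<sigma> \<longleftrightarrow>
     is_interval I \<and> \<sigma> ` I \<subseteq> M \<and> absolutely_continuous_curve I \<sigma> \<and>
     (\<forall>s\<in>I. \<forall>t\<in>I. ereal (\<bar>t - s\<bar> - \<kappa>) \<le> kobayashi_dist M (\<sigma> t) (\<sigma> s) \<and>
                  kobayashi_dist M (\<sigma> t) (\<sigma> s) \<le> ereal (\<bar>t - s\<bar> + \<kappa>)) \<and>
     (AE t in lebesgue_on I.
        \<exists>v. (\<sigma> has_vector_derivative v) (at t within I) \<and> kobayashi_metric M (\<sigma> t) v \<le> 1)"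

definition visibility_property :: "(complex^'d) set \<Rightarrow> real \<Rightarrow> bool" where
  "visibility_property M \<kappa> \<longleftrightarrow>
     (\<forall>z\<in>M. \<forall>w\<in>M. z \<noteq> w \<longrightarrow>
        (\<exists>a b \<sigma>. a \<le> b \<and> almost_geodesic M \<kappa> {a..b} \<sigma> \<and> \<sigma> a = z \<and> \<sigma> b = w)) \<and>
     (\<forall>p\<in>submanifold_boundary M. \<forall>q\<in>submanifold_boundary M. p \<noteq> q \<longrightarrow>
        (\<exists>V W K. open V \<and> p \<in> V \<and> open W \<and> q \<in> W \<and> closure V \<inter> closure W = {} \<and>
           compact K \<and> K \<subseteq> M \<and>
           (\<forall>a b \<sigma>. a \<le> b \<and> almost_geodesic M \<kappa> {a..b} \<sigma> \<and> \<sigma> a \<in> V \<and> \<sigma> b \<in> W \<longrightarrow>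
              \<sigma> ` {a..b} \<inter> K \<noteq> {})))"

definition weak_visibility_property :: "(complex^'d) set \<Rightarrow> bool" where
  "weak_visibility_property M \<longleftrightarrow> (\<forall>\<kappa>>0. visibility_property M \<kappa>)"

end

theory Submission
  imports Defs
begin

text \<open>
  Let \<open>k\<close> be the Kobayashi distance. The map \<open>F\<close> does not increase \<open>k\<close>, and boundedness of \<open>M\<close>
  together with the slice charts shows that \<open>k\<close> induces the Euclidean topology on \<open>M\<close>.

  If some orbit has a cluster point \<open>y\<close> in \<open>M\<close>, then \<open>y\<close> is recurrent, \<open>F\<close> is isometric on its orbit, and a
  compactness argument on return times bounds the orbit; tautness carries this along chains of discs to all
  orbits. Otherwise the iterates diverge compactly. As the lower bound in the definition of an
  almost-geodesic is void for curves of length at most \<open>\<kappa>\<close>, the map \<open>F\<close> sends such almost-geodesics to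
  almost-geodesics. Visibility then shows that the limit of a subsequence of \<open>F\<^sup>n z\<close> does not depend on \<open>z\<close>, and
  that two subsequences of an orbit staying at bounded distance have the same limit. Comparing with times at which
  \<open>k z (F\<^sup>n z)\<close> attains a record, one gets uniqueness of the limit even for orbits with \<open>k\<close>-unbounded
  displacement, although \<open>k\<close> need not be complete.
\<close>

section \<open>Nonexpansive maps of locally compact spaces\<close>

text \<open>Besides the metric axioms and local compactness, the dynamical part uses of
  \<open>k\<close> only that it dominates a multiple of the Euclidean distance, is small near each
  point and is not increased by \<open>F\<close>; the first locale records this. Because
  \<open>k\<close>-bounded sets need not be relatively compact, leaving all compact sets says
  nothing about the size of \<open>a n = k z (F^n z)\<close>. If \<open>a\<close> is bounded, any
  two subsequences of the orbit are at bounded distance. If not, let \<open>n\<close> run through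
  record times leading to \<xi>, and \<open>m\<close> through times leading to some \<eta> different
  from \<xi>. Curves joining the two kinds of points meet a fixed compact set, so
  \<open>a m + a n - k (F^m z) (F^n z)\<close> is bounded (a Gromov product), while
  \<open>k (F^m z) (F^n z) \<le> a (n - m) \<le> a n\<close> for \<open>m \<le> n\<close>. Hence
  \<open>a m\<close> is bounded. The points with times \<open>n\<close> and \<open>n + m\<close> are
  then at bounded distance, but for fixed \<open>n\<close> the latter tend to \<eta>, since limits
  do not depend on the starting point; a diagonal choice contradicts the bounded-distance
  case.\<close>

lemma LIMSEQ_if_unique_cluster_point:
  fixes x :: "nat \<Rightarrow> 'a::metric_space"
  assumes "compact S" "\<And>n. x n \<in> S"
    and uniq: "\<And>r l. strict_mono r \<Longrightarrow> (\<lambda>i. x (r i)) \<longlonglongrightarrow> l \<Longrightarrow> l = \<xi>"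
  shows "x \<longlonglongrightarrow> \<xi>"
proof (rule ccontr)
  assume "\<not> x \<longlonglongrightarrow> \<xi>"
  then obtain e where e: "e > 0" "\<not> (\<forall>\<^sub>F n in sequentially. dist (x n) \<xi> < e)"
    unfolding tendsto_iff by blast
  define A where "A = {n. \<not> dist (x n) \<xi> < e}"
  have "infinite A"
    using e(2) unfolding A_def eventually_sequentially infinite_nat_iff_unbounded_le by auto
  then have enum: "strict_mono (enumerate A)" "\<And>n. enumerate A n \<in> A"
    by (auto simp: strict_mono_enumerate enumerate_in_set)
  obtain l r where lr: "l \<in> S" "strict_mono (r :: nat \<Rightarrow> nat)" "((x \<circ> enumerate A) \<circ> r) \<longlonglongrightarrow> l"
    using assms(1,2) unfolding compact_def by (metis comp_apply)
  have "l = \<xi>"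
    using uniq[of "enumerate A \<circ> r" l] lr strict_mono_o[OF enum(1) lr(2)] by (auto simp: o_def)
  then have "\<forall>\<^sub>F n in sequentially. dist (x (enumerate A (r n))) \<xi> < e"
    using lr(3) e(1) by (auto simp: tendsto_iff o_def)
  then show False
    using enum(2) unfolding A_def eventually_sequentially by blast
qed

text \<open>\<open>dist_le\<close> is uniform on \<open>M\<close>, whereas \<open>d_small\<close> is
  pointwise; finite nets of compact sets supply the uniformity. Completeness is deliberately absent:
  closed \<open>d\<close>-balls need not be compact, so compactness has to come from
  \<open>M\<close> itself.\<close>

locale nonexpansive_map =
  fixes M :: "'a::euclidean_space set" and d :: "'a \<Rightarrow> 'a \<Rightarrow> real" and F :: "'a \<Rightarrow> 'a" and C :: real
  assumes locally_compact: "locally compact M"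
    and C_pos: "0 < C"
    and d_refl: "x \<in> M \<Longrightarrow> d x x = 0"
    and d_sym: "x \<in> M \<Longrightarrow> y \<in> M \<Longrightarrow> d x y = d y x"
    and d_triangle: "x \<in> M \<Longrightarrow> y \<in> M \<Longrightarrow> z \<in> M \<Longrightarrow> d x z \<le> d x y + d y z"
    and dist_le: "x \<in> M \<Longrightarrow> y \<in> M \<Longrightarrow> dist x y \<le> C * d x y"
    and d_small: "x \<in> M \<Longrightarrow> 0 < e \<Longrightarrow> \<exists>\<delta>>0. \<forall>y\<in>M. dist y x < \<delta> \<longrightarrow> d y x < e"
    and maps: "x \<in> M \<Longrightarrow> F x \<in> M"
    and nonexpansive: "x \<in> M \<Longrightarrow> y \<in> M \<Longrightarrow> d (F x) (F y) \<le> d x y"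
begin

lemma d_nonneg: "x \<in> M \<Longrightarrow> y \<in> M \<Longrightarrow> 0 \<le> d x y"
  using order_trans[OF zero_le_dist dist_le[of x y]] C_pos by (simp add: zero_le_mult_iff)

lemma funpow_in: "x \<in> M \<Longrightarrow> (F ^^ n) x \<in> M"
  by (induction n) (auto simp: maps)

lemma funpow_nonexpansive: "x \<in> M \<Longrightarrow> y \<in> M \<Longrightarrow> d ((F ^^ n) x) ((F ^^ n) y) \<le> d x y"
  by (induction n) (auto intro: order_trans[OF nonexpansive] simp: funpow_in)

lemma funpow_nonexpansive':
  "x \<in> M \<Longrightarrow> d ((F ^^ (n + a)) x) ((F ^^ (n + b)) x) \<le> d ((F ^^ a) x) ((F ^^ b) x)"
  using funpow_nonexpansive[of "(F ^^ a) x" "(F ^^ b) x" n] by (simp add: funpow_in funpow_add)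

lemma d_tendsto:
  assumes "x \<longlonglongrightarrow> l" "l \<in> M" "\<And>n. x n \<in> M"
  shows "(\<lambda>n. d (x n) l) \<longlonglongrightarrow> 0"
  unfolding tendsto_iff
proof (intro allI impI)
  fix e :: real assume "0 < e"
  then obtain \<delta> where \<delta>: "\<delta> > 0" "\<forall>y\<in>M. dist y l < \<delta> \<longrightarrow> d y l < e"
    using d_small assms(2) by blast
  have "\<forall>\<^sub>F n in sequentially. dist (x n) l < \<delta>"
    using assms(1) \<delta>(1) by (simp add: tendsto_iff)
  then show "\<forall>\<^sub>F n in sequentially. dist (d (x n) l) 0 < e"
    by eventually_elim (use \<delta> assms d_nonneg in \<open>auto simp: dist_real_def\<close>)
qed

lemma continuous_on_funpow: "continuous_on M (F ^^ n)"
proof (clarsimp simp: continuous_on_iff)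
  fix x :: "'a" and e :: real assume xe: "x \<in> M" "0 < e"
  obtain \<delta> where \<delta>: "\<delta> > 0" "\<forall>y\<in>M. dist y x < \<delta> \<longrightarrow> d y x < e / C"
    using d_small[of x "e / C"] xe C_pos by auto
  have "dist ((F ^^ n) y) ((F ^^ n) x) < e" if "y \<in> M" "dist y x < \<delta>" for y
  proof -
    have "dist ((F ^^ n) y) ((F ^^ n) x) \<le> C * d ((F ^^ n) y) ((F ^^ n) x)"
      using dist_le funpow_in xe that by auto
    also have "\<dots> \<le> C * d y x"
      using funpow_nonexpansive[of y x n] xe that C_pos by simp
    also have "\<dots> < e"
      using \<delta> that C_pos by (simp add: field_simps)
    finally show ?thesis .
  qed
  then show "\<exists>\<delta>>0. \<forall>y\<in>M. dist y x < \<delta> \<longrightarrow> dist ((F ^^ n) y) ((F ^^ n) x) < e"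
    using \<delta>(1) by blast
qed

text \<open>Substitute for compactness of \<open>d\<close>-balls. A locally compact set has the form
  \<open>A \<inter> U\<close> with \<open>A\<close> closed and \<open>U\<close> open; a closed
  Euclidean tube about \<open>Q\<close> inside \<open>U\<close> cuts \<open>A\<close> in a compact
  set, and \<open>dist_le\<close> turns its width \<open>e\<close> into the \<open>d\<close>-radius
  \<open>e / C\<close>.\<close>

lemma compact_neighbourhood:
  assumes Q: "compact Q" "Q \<subseteq> M"
  obtains e Q' where "0 < e" "compact Q'" "Q' \<subseteq> M"
    "\<forall>x\<in>M. \<forall>q\<in>Q. d x q < e \<longrightarrow> x \<in> Q'"
proof (cases "Q = {}")
  case True
  then show ?thesis using that[of 1 "{}"] by auto
next
  case False
  obtain A U where AU: "closed A" "open U" "M = A \<inter> U"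
    using locally_compact unfolding locally_compact_closed_Int_open by blast
  obtain e where e: "e > 0" "{x. infdist x Q \<le> e} \<subseteq> U"
    using compact_in_open_separated[of Q U] False Q AU by auto
  have "compact (A \<inter> {x. infdist x Q \<le> e})"
    by (intro closed_Int_compact AU compact_infdist_le False Q e)
  moreover have "x \<in> A \<inter> {x. infdist x Q \<le> e}" if "x \<in> M" "q \<in> Q" "d x q < e / C" for x q
  proof -
    have "infdist x Q \<le> dist x q" using that by (intro infdist_le) auto
    also have "\<dots> \<le> C * d x q" using that Q dist_le by auto
    also have "\<dots> \<le> e" using that C_pos by (simp add: field_simps)
    finally show ?thesis using that AU by auto
  qed
  ultimately show ?thesis
    using that[of "e / C" "A \<inter> {x. infdist x Q \<le> e}"] e C_pos AU by auto
qed

text \<open>The net consists of values \<open>f j\<close> rather than arbitrary points of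
  \<open>Q\<close>, so that it can be indexed by return times; replacing the centres of a cover by
  such values costs the factor 2 in the radius.\<close>

lemma finite_net:
  assumes Q: "compact Q" "Q \<subseteq> M" and sub: "f ` I \<subseteq> Q" and "0 < e"
  obtains J where "finite J" "J \<subseteq> I" "\<forall>i\<in>I. \<exists>j\<in>J. d (f i) (f j) < e"
proof -
  have "\<forall>x\<in>Q. \<exists>\<delta>>0. \<forall>y\<in>M. dist y x < \<delta> \<longrightarrow> d y x < e / 2"
    using d_small[of _ "e / 2"] Q \<open>0 < e\<close> by auto
  then obtain \<delta> where \<delta>: "\<And>x. x \<in> Q \<Longrightarrow> \<delta> x > 0"
    "\<And>x y. x \<in> Q \<Longrightarrow> y \<in> M \<Longrightarrow> dist y x < \<delta> x \<Longrightarrow> d y x < e / 2" by metis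
  obtain T where T: "T \<subseteq> Q" "finite T" "Q \<subseteq> (\<Union>x\<in>T. ball x (\<delta> x))"
    by (rule compactE_image[OF Q(1), of Q "\<lambda>x. ball x (\<delta> x)"]) (use \<delta> in force)+
  define g where "g x = (SOME i. i \<in> I \<and> f i \<in> ball x (\<delta> x))" for x
  define J where "J = g ` {x \<in> T. \<exists>i\<in>I. f i \<in> ball x (\<delta> x)}"
  have g: "g x \<in> I \<and> f (g x) \<in> ball x (\<delta> x)" if "i \<in> I" "f i \<in> ball x (\<delta> x)" for i x
    unfolding g_def by (rule someI[where x = i]) (use that in auto)
  show thesis
  proof
    show "finite J" "J \<subseteq> I" using T g by (auto simp: J_def)
    show "\<forall>i\<in>I. \<exists>j\<in>J. d (f i) (f j) < e"
    proof
      fix i assume i: "i \<in> I"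
      then obtain x where x: "x \<in> T" "f i \<in> ball x (\<delta> x)" using T sub by blast
      have gx: "g x \<in> I" "f (g x) \<in> ball x (\<delta> x)" using g[OF i x(2)] by auto
      have M: "f i \<in> M" "f (g x) \<in> M" "x \<in> M" using sub i gx Q T x by auto
      have "d (f i) (f (g x)) \<le> d (f i) x + d (f (g x)) x"
        using d_triangle[of "f i" x "f (g x)"] d_sym M by auto
      also have "\<dots> < e"
        using \<delta>(2)[of x "f i"] \<delta>(2)[of x "f (g x)"] M x gx T by (auto simp: dist_commute)
      finally show "\<exists>j\<in>J. d (f i) (f j) < e"
        using x i by (auto simp: J_def)
    qed
  qed
qed

section \<open>Recurrence and relatively compact orbits\<close>

lemma recurrent_if_cluster_point:
  assumes "z \<in> M" "y \<in> M" "strict_mono r" "(\<lambda>i. (F ^^ r i) z) \<longlonglongrightarrow> y" "0 < e"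
  shows "\<exists>n\<ge>N. d ((F ^^ n) y) y < e"
proof -
  have "(\<lambda>i. d ((F ^^ r i) z) y) \<longlonglongrightarrow> 0"
    using assms funpow_in by (intro d_tendsto) auto
  then have "\<forall>\<^sub>F i in sequentially. d ((F ^^ r i) z) y < e / 2"
    using assms(5) by (intro order_tendstoD(2)[of _ 0]) auto
  then obtain I where I: "\<And>i. i \<ge> I \<Longrightarrow> d ((F ^^ r i) z) y < e / 2"
    by (auto simp: eventually_sequentially)
  \<comment> \<open>The iterate \<open>n = r j - r I\<close> carries one orbit point near
    \<open>y\<close> to another, and nonexpansiveness lets \<open>y\<close> replace the first. As
    \<open>r j \<ge> j\<close>, the summand \<open>N\<close> gives \<open>n \<ge> N\<close>; the
    summand \<open>I\<close> gives \<open>j \<ge> I\<close>.\<close>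
  define j where "j = r I + N + I"
  define n where "n = r j - r I"
  have "r j \<ge> j" using assms(3) by (rule strict_mono_imp_increasing)
  then have n: "n \<ge> N" "r j = n + r I" by (auto simp: n_def j_def)
  have "d ((F ^^ n) y) y \<le> d ((F ^^ n) y) ((F ^^ n) ((F ^^ r I) z)) + d ((F ^^ r j) z) y"
    using d_triangle[of "(F ^^ n) y" "(F ^^ r j) z" y] assms funpow_in by (simp add: n funpow_add)
  also have "d ((F ^^ n) y) ((F ^^ n) ((F ^^ r I) z)) \<le> d ((F ^^ r I) z) y"
    using funpow_nonexpansive[of y "(F ^^ r I) z" n] assms funpow_in d_sym by auto
  also have "d ((F ^^ r I) z) y + d ((F ^^ r j) z) y < e"
    using I[of I] I[of j] by (auto simp: j_def)
  finally show ?thesis using n(1) by auto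
qed

text \<open>As \<open>a\<close> grows, the right-hand side can only decrease, yet at late return
  times it comes back arbitrarily close to its value at \<open>a = 0\<close>; so it never drops
  below that value.\<close>

lemma isometry_on_recurrent_orbit:
  assumes y: "y \<in> M" and rec: "\<And>e N. 0 < e \<Longrightarrow> \<exists>n\<ge>N. d ((F ^^ n) y) y < e"
  shows "d y ((F ^^ b) y) \<le> d ((F ^^ a) y) ((F ^^ (a + b)) y)"
proof (rule field_le_epsilon)
  fix e :: real assume "0 < e"
  then obtain n where n: "n \<ge> a" "d ((F ^^ n) y) y < e / 2" using rec[of "e / 2" a] by auto
  have *: "(F ^^ (n + b)) y = (F ^^ b) ((F ^^ n) y)" by (metis add.commute comp_apply funpow_add)
  have "d y ((F ^^ b) y) \<le> d y ((F ^^ n) y) + d ((F ^^ n) y) ((F ^^ b) y)"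
    using y funpow_in by (intro d_triangle) auto
  also have "d ((F ^^ n) y) ((F ^^ b) y) \<le> d ((F ^^ n) y) ((F ^^ (n + b)) y) + d ((F ^^ (n + b)) y) ((F ^^ b) y)"
    using y funpow_in by (intro d_triangle) auto
  also have "d ((F ^^ (n + b)) y) ((F ^^ b) y) \<le> d ((F ^^ n) y) y"
    unfolding * using y funpow_in by (intro funpow_nonexpansive) auto
  also have "d ((F ^^ n) y) ((F ^^ (n + b)) y) \<le> d ((F ^^ a) y) ((F ^^ (a + b)) y)"
    using funpow_nonexpansive'[of y "n - a" a "a + b"] n y by simp
  also have "d y ((F ^^ n) y) = d ((F ^^ n) y) y" using y funpow_in d_sym by auto
  finally show "d y ((F ^^ b) y) \<le> d ((F ^^ a) y) ((F ^^ (a + b)) y) + e"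
    using n by simp
qed

text \<open>
  On the recurrent orbit \<open>F\<close> is an isometry, so the return times to a small ball have bounded gaps: descending from
  a late return time by one of finitely many steps leads to another return time.
\<close>

lemma recurrent_orbit_relatively_compact:
  assumes y: "y \<in> M" and rec: "\<And>e N. 0 < e \<Longrightarrow> \<exists>n\<ge>N. d ((F ^^ n) y) y < e"
  obtains Q where "compact Q" "Q \<subseteq> M" "\<forall>n. (F ^^ n) y \<in> Q"
proof -
  obtain e B where B: "0 < e" "compact B" "B \<subseteq> M" "\<forall>x\<in>M. \<forall>q\<in>{y}. d x q < e \<longrightarrow> x \<in> B"
    by (rule compact_neighbourhood[of "{y}"]) (use y in auto)
  define V where "V = {k. d ((F ^^ k) y) y < e}"
  have VB: "(F ^^ k) y \<in> B" if "k \<in> V" for k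
    using that y B(4) funpow_in[of y k] by (auto simp: V_def)
  \<comment> \<open>Time 0 is always a return time; excluding it makes every step in
    \<open>J\<close> positive, so that subtracting a step really descends.\<close>
  have "(\<lambda>k. (F ^^ k) y) ` {k \<in> V. k \<ge> 1} \<subseteq> B" using VB by auto
  then obtain J where J: "finite J" "J \<subseteq> {k \<in> V. k \<ge> 1}"
    "\<forall>k\<in>{k \<in> V. k \<ge> 1}. \<exists>j\<in>J. d ((F ^^ k) y) ((F ^^ j) y) < e"
    by (rule finite_net[OF B(2,3) _ B(1)])
  obtain m where m: "\<And>j. j \<in> J \<Longrightarrow> j \<le> m"
    using J(1) by (meson finite_nat_set_iff_bounded_le)
  have step: "\<exists>j\<in>J. k - j \<in> V" if k: "k \<in> V" "k > m" for k
  proof -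
    obtain j where j: "j \<in> J" "d ((F ^^ k) y) ((F ^^ j) y) < e" using J(3) k by force
    have "j \<le> k" using m[OF j(1)] k by simp
    then have "d y ((F ^^ (k - j)) y) \<le> d ((F ^^ j) y) ((F ^^ k) y)"
      using isometry_on_recurrent_orbit[OF assms, of "k - j" j] by simp
    then have "k - j \<in> V" using j y funpow_in d_sym by (auto simp: V_def)
    then show ?thesis using j by blast
  qed
  have gap: "\<exists>k\<in>V. k \<le> n \<and> n \<le> k + m" if nm: "n > m" for n
  proof -
    obtain N where "N \<ge> n" "N \<in> V" using rec[of e n] B by (auto simp: V_def)
    then have ex: "\<exists>k. k \<in> V \<and> k \<ge> n" by blast
    \<comment> \<open>Leastness forces the return time \<open>k - j\<close> below \<open>n\<close>,
      and \<open>j \<le> m\<close> keeps it at most \<open>m\<close> below.\<close>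
    define k where "k = (LEAST k. k \<in> V \<and> k \<ge> n)"
    have k: "k \<in> V" "k \<ge> n" using LeastI_ex[OF ex] by (auto simp: k_def)
    obtain j where j: "j \<in> J" "k - j \<in> V" using step k nm by force
    have "1 \<le> j" "j \<le> m" using J j m by auto
    then have "k - j < k" using k nm by auto
    then have "\<not> k - j \<ge> n" using j not_less_Least[of "k - j" "\<lambda>k. k \<in> V \<and> k \<ge> n"] by (auto simp: k_def)
    then show ?thesis using j k \<open>j \<le> m\<close> by (intro bexI[of _ "k - j"]) auto
  qed
  \<comment> \<open>The images of \<open>B\<close> serve the times beyond \<open>m\<close>, those of
    \<open>y\<close> the times up to \<open>m\<close>.\<close>
  define Q where "Q = (\<Union>i\<le>m. (F ^^ i) ` (insert y B))"
  have "compact Q" unfolding Q_def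
    by (intro compact_UN compact_continuous_image continuous_on_subset[OF continuous_on_funpow] compact_insert B)
      (use B y in auto)
  moreover have "Q \<subseteq> M" using B y funpow_in by (auto simp: Q_def)
  moreover have "(F ^^ n) y \<in> Q" for n
  proof (cases "n \<le> m")
    case True
    then show ?thesis by (auto simp: Q_def)
  next
    case False
    then obtain k where k: "k \<in> V" "k \<le> n" "n \<le> k + m" using gap[of n] by auto
    have "(F ^^ n) y = (F ^^ (n - k)) ((F ^^ k) y)"
      using k by (metis add.commute comp_apply funpow_add le_add_diff_inverse)
    then show ?thesis using VB[OF k(1)] k by (auto simp: Q_def)
  qed
  ultimately show thesis using that by blast
qed

text \<open>The orbit of the cluster point \<open>y\<close> lies in a compact set by recurrence.
  Once an iterate of \<open>z\<close> is within \<open>e\<close> of \<open>y\<close>, all later ones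
  shadow the orbit of \<open>y\<close> within \<open>e\<close> and stay in a compact neighbourhood;
  only finitely many iterates come earlier.\<close>

proposition orbit_relatively_compact:
  assumes z: "z \<in> M" and y: "y \<in> M" and r: "strict_mono r" and lim: "(\<lambda>i. (F ^^ r i) z) \<longlonglongrightarrow> y"
  obtains Q where "compact Q" "Q \<subseteq> M" "\<forall>n. (F ^^ n) z \<in> Q"
proof -
  obtain Q where Q: "compact Q" "Q \<subseteq> M" "\<forall>n. (F ^^ n) y \<in> Q"
    by (rule recurrent_orbit_relatively_compact[OF y recurrent_if_cluster_point[OF z y r lim]])
  obtain e Q' where Q': "0 < e" "compact Q'" "Q' \<subseteq> M"
    "\<forall>x\<in>M. \<forall>q\<in>Q. d x q < e \<longrightarrow> x \<in> Q'"
    by (rule compact_neighbourhood[OF Q(1,2)])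
  have "(\<lambda>i. d ((F ^^ r i) z) y) \<longlonglongrightarrow> 0"
    using z y lim funpow_in by (intro d_tendsto) auto
  then have "\<forall>\<^sub>F i in sequentially. d ((F ^^ r i) z) y < e"
    using Q'(1) by (intro order_tendstoD(2)[of _ 0]) auto
  then obtain p where p: "d ((F ^^ p) z) y < e"
    by (auto simp: eventually_sequentially)
  have late: "(F ^^ (l + p)) z \<in> Q'" for l
  proof -
    have "d ((F ^^ (l + p)) z) ((F ^^ l) y) < e"
      using funpow_nonexpansive[of "(F ^^ p) z" y l] p z y funpow_in by (simp add: funpow_add)
    then show ?thesis using Q'(4) Q(3) z funpow_in by blast
  qed
  define R where "R = Q' \<union> (\<lambda>n. (F ^^ n) z) ` {..p}"
  have "(F ^^ n) z \<in> R" for n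
    using late[of "n - p"] by (cases "n \<le> p") (auto simp: R_def)
  moreover have "compact R" "R \<subseteq> M"
    using Q' z funpow_in by (auto simp: R_def intro!: compact_Un finite_imp_compact[OF finite_imageI])
  ultimately show thesis using that by blast
qed

end

section \<open>Visibility and divergent iterates\<close>

text \<open>Pigeonhole: each cell of length \<open>e\<close> contains at most one of the
  \<open>N + 1\<close> points. The points need not be monotone in the index, so consecutive gaps
  cannot simply be added.\<close>

lemma separated_points_bound:
  fixes t :: "nat \<Rightarrow> real"
  assumes "\<And>k. k \<le> N \<Longrightarrow> t k \<in> {a..b}" and "0 < e"
    and sep: "\<And>j k. j < k \<Longrightarrow> k \<le> N \<Longrightarrow> e \<le> \<bar>t j - t k\<bar>"
  shows "real N * e \<le> b - a"
proof -
  define f where "f k = \<lfloor>(t k - a) / e\<rfloor>" for k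
  have "inj_on f {..N}"
  proof (rule linorder_inj_onI')
    fix j k assume "j \<in> {..N}" "k \<in> {..N}" "j < k"
    then have "e \<le> \<bar>t j - t k\<bar>" using sep by auto
    then have "1 \<le> \<bar>(t j - a) / e - (t k - a) / e\<bar>"
      using \<open>0 < e\<close> by (simp add: diff_divide_distrib[symmetric] field_simps)
    then show "f j \<noteq> f k"
      unfolding f_def by linarith
  qed
  moreover have "f ` {..N} \<subseteq> {0..\<lfloor>(b - a) / e\<rfloor>}"
    using assms(1,2) by (force simp: f_def intro!: floor_mono divide_right_mono)
  ultimately have "card {..N} \<le> card {0..\<lfloor>(b - a) / e\<rfloor>}"
    by (intro card_inj_on_le) auto
  then have "real N \<le> (b - a) / e" by simp linarith
  then show ?thesis using \<open>0 < e\<close> by (simp add: field_simps)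
qed

lemma compact_imp_cluster_point:
  fixes x :: "nat \<Rightarrow> 'a::metric_space"
  assumes "compact S" "\<And>n. x n \<in> S"
  obtains r l where "strict_mono (r :: nat \<Rightarrow> nat)" "(\<lambda>i. x (r i)) \<longlonglongrightarrow> l"
proof -
  have "\<forall>n. x n \<in> S" using assms(2) by blast
  then show thesis using assms(1) that unfolding compact_def o_def by blast
qed

text \<open>The first time at which \<open>a\<close> exceeds its maximum over \<open>{..N}\<close>
  is such a record.\<close>

lemma unbounded_records:
  fixes a :: "nat \<Rightarrow> real"
  assumes "\<nexists>B. \<forall>n. a n \<le> B"
  shows "\<exists>\<nu>\<ge>N. \<forall>j\<le>\<nu>. a j \<le> a \<nu>"
proof -
  define B where "B = Max (a ` {..N})"
  have B: "a j \<le> B" if "j \<le> N" for j using that by (auto simp: B_def)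
  define \<nu> where "\<nu> = (LEAST n. B < a n)"
  have "\<exists>n. B < a n" using assms by (meson not_le)
  then have \<nu>: "B < a \<nu>" unfolding \<nu>_def by (rule LeastI_ex)
  have less: "a j \<le> B" if "j < \<nu>" for j using not_less_Least[of j "\<lambda>n. B < a n"] that by (auto simp: \<nu>_def)
  have "a j \<le> a \<nu>" if "j \<le> \<nu>" for j
    using less[of j] \<nu> that by (cases "j = \<nu>") auto
  moreover have "N \<le> \<nu>" using B[of \<nu>] \<nu> by (meson nle_le not_le)
  ultimately show ?thesis by blast
qed

text \<open>\<open>\<Gamma> \<kappa> a b \<tau>\<close> abstracts from \<open>\<tau>\<close> being a \<open>(1, \<kappa>)\<close>-almost-geodesic on \<open>[a, b]\<close>.\<close>

locale visibility_dynamics = nonexpansive_map M d F C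
  for M :: "'a::euclidean_space set" and d F C +
  fixes \<Gamma> :: "real \<Rightarrow> real \<Rightarrow> real \<Rightarrow> (real \<Rightarrow> 'a) \<Rightarrow> bool"
  assumes bounded: "bounded M"
    and curve_le: "\<Gamma> \<kappa> a b \<tau> \<Longrightarrow> a \<le> b"
    and curve_in: "\<Gamma> \<kappa> a b \<tau> \<Longrightarrow> t \<in> {a..b} \<Longrightarrow> \<tau> t \<in> M"
    and curve_compact: "\<Gamma> \<kappa> a b \<tau> \<Longrightarrow> compact (\<tau> ` {a..b})"
    and curve_upper: "\<Gamma> \<kappa> a b \<tau> \<Longrightarrow> s \<in> {a..b} \<Longrightarrow> t \<in> {a..b} \<Longrightarrow> d (\<tau> s) (\<tau> t) \<le> \<bar>s - t\<bar> + \<kappa>"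
    and curve_lower: "\<Gamma> \<kappa> a b \<tau> \<Longrightarrow> s \<in> {a..b} \<Longrightarrow> t \<in> {a..b} \<Longrightarrow> \<bar>s - t\<bar> - \<kappa> \<le> d (\<tau> s) (\<tau> t)"
    and curve_mono: "\<Gamma> \<kappa> a b \<tau> \<Longrightarrow> \<kappa> \<le> \<kappa>' \<Longrightarrow> \<Gamma> \<kappa>' a b \<tau>"
    and curve_image: "\<Gamma> \<kappa> a b \<tau> \<Longrightarrow> b - a \<le> \<kappa> \<Longrightarrow> \<Gamma> \<kappa> a b (F \<circ> \<tau>)"
    and curve_ex: "z \<in> M \<Longrightarrow> w \<in> M \<Longrightarrow> z \<noteq> w \<Longrightarrow> 0 < \<kappa> \<Longrightarrow> \<exists>a b \<tau>. \<Gamma> \<kappa> a b \<tau> \<and> \<tau> a = z \<and> \<tau> b = w"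
    and visible: "p \<in> closure M - M \<Longrightarrow> q \<in> closure M - M \<Longrightarrow> p \<noteq> q \<Longrightarrow> 0 < \<kappa> \<Longrightarrow>
      \<exists>V W K. open V \<and> p \<in> V \<and> open W \<and> q \<in> W \<and> V \<inter> W = {} \<and> compact K \<and> K \<subseteq> M \<and>
        (\<forall>a b \<tau>. \<Gamma> \<kappa> a b \<tau> \<and> \<tau> a \<in> V \<and> \<tau> b \<in> W \<longrightarrow> \<tau> ` {a..b} \<inter> K \<noteq> {})"
    and divergent: "z \<in> M \<Longrightarrow> compact K \<Longrightarrow> K \<subseteq> M \<Longrightarrow> \<forall>\<^sub>F n in sequentially. (F ^^ n) z \<notin> K"
begin

lemma curve_funpow: "\<Gamma> \<kappa> a b \<tau> \<Longrightarrow> b - a \<le> \<kappa> \<Longrightarrow> \<Gamma> \<kappa> a b (F ^^ n \<circ> \<tau>)"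
  by (induction n) (auto simp: o_assoc dest: curve_image)

lemma visibleE:
  assumes "p \<in> closure M - M" "q \<in> closure M - M" "p \<noteq> q" "0 < \<kappa>"
  obtains V W K where "open V" "p \<in> V" "open W" "q \<in> W" "V \<inter> W = {}" "compact K" "K \<subseteq> M"
    "\<forall>a b \<tau>. \<Gamma> \<kappa> a b \<tau> \<longrightarrow> \<tau> a \<in> V \<longrightarrow> \<tau> b \<in> W \<longrightarrow> (\<exists>t\<in>{a..b}. \<tau> t \<in> K)"
proof -
  obtain V W K where VWK: "open V" "p \<in> V" "open W" "q \<in> W" "V \<inter> W = {}" "compact K" "K \<subseteq> M"
    and vis: "\<forall>a b \<tau>. \<Gamma> \<kappa> a b \<tau> \<and> \<tau> a \<in> V \<and> \<tau> b \<in> W \<longrightarrow> \<tau> ` {a..b} \<inter> K \<noteq> {}"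
    using visible[OF assms] by blast
  show thesis
  proof (rule that[OF VWK], intro allI impI)
    fix a b \<tau> assume "\<Gamma> \<kappa> a b \<tau>" "\<tau> a \<in> V" "\<tau> b \<in> W"
    then have "\<tau> ` {a..b} \<inter> K \<noteq> {}" using vis by blast
    then show "\<exists>t\<in>{a..b}. \<tau> t \<in> K" by blast
  qed
qed

text \<open>Pointwise divergence on a finite net of \<open>K\<close> suffices if it is tested
  against an enlarged target: were \<open>(F ^^ n) x\<close> in \<open>L\<close>, the iterate of a
  nearby net point would be in \<open>L'\<close>.\<close>

lemma compactly_divergent_iterates:
  assumes K: "compact K" "K \<subseteq> M" and L: "compact L" "L \<subseteq> M"
  shows "\<forall>\<^sub>F n in sequentially. \<forall>x\<in>K. (F ^^ n) x \<notin> L"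
proof -
  obtain e L' where L': "0 < e" "compact L'" "L' \<subseteq> M" "\<forall>x\<in>M. \<forall>q\<in>L. d x q < e \<longrightarrow> x \<in> L'"
    by (rule compact_neighbourhood[OF L])
  obtain J where J: "finite J" "J \<subseteq> K" "\<forall>x\<in>K. \<exists>j\<in>J. d x j < e"
    by (rule finite_net[of K "\<lambda>x. x" K e]) (use K L' in auto)
  have "\<forall>\<^sub>F n in sequentially. \<forall>j\<in>J. (F ^^ n) j \<notin> L'"
    using J K L' divergent by (intro eventually_ball_finite) auto
  then show ?thesis
  proof eventually_elim
    case (elim n)
    show ?case
    proof
      fix x assume x: "x \<in> K"
      then obtain j where j: "j \<in> J" "d x j < e" using J by blast
      have M: "x \<in> M" "j \<in> M" using x j J K by auto
      have "d ((F ^^ n) j) ((F ^^ n) x) < e"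
        using funpow_nonexpansive[of j x n] j d_sym M by auto
      then show "(F ^^ n) x \<notin> L" using L'(4) elim j M funpow_in by blast
    qed
  qed
qed

text \<open>All iterates share one modulus of continuity with respect to \<open>d\<close>, with
  constant \<open>C\<close>, so convergence on a finite net is enough.\<close>

lemma uniform_limit_iterates:
  assumes K: "compact K" "K \<subseteq> M" and lim: "\<And>z. z \<in> M \<Longrightarrow> (\<lambda>n. (F ^^ n) z) \<longlonglongrightarrow> \<xi>"
  shows "uniform_limit K (\<lambda>n. F ^^ n) (\<lambda>_. \<xi>) sequentially"
proof (rule uniform_limitI)
  fix e :: real assume "0 < e"
  then have e: "0 < e / (2 * C)" using C_pos by simp
  obtain J where J: "finite J" "J \<subseteq> K" "\<forall>x\<in>K. \<exists>j\<in>J. d x j < e / (2 * C)"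
    by (rule finite_net[of K "\<lambda>x. x" K "e / (2 * C)"]) (use K e in auto)
  have "\<forall>\<^sub>F n in sequentially. \<forall>j\<in>J. dist ((F ^^ n) j) \<xi> < e / 2"
    using J K lim \<open>0 < e\<close> by (intro eventually_ball_finite ballI tendstoD) auto
  then show "\<forall>\<^sub>F n in sequentially. \<forall>x\<in>K. dist ((F ^^ n) x) \<xi> < e"
  proof eventually_elim
    case (elim n)
    show ?case
    proof
      fix x assume x: "x \<in> K"
      then obtain j where j: "j \<in> J" "d x j < e / (2 * C)" using J by blast
      have M: "x \<in> M" "j \<in> M" using x j J K by auto
      have "dist ((F ^^ n) x) ((F ^^ n) j) \<le> C * d ((F ^^ n) x) ((F ^^ n) j)"
        using M funpow_in by (intro dist_le) auto
      also have "\<dots> \<le> C * d x j"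
        using funpow_nonexpansive M C_pos by auto
      also have "\<dots> < e / 2"
        using j C_pos by (simp add: field_simps)
      finally show "dist ((F ^^ n) x) \<xi> < e"
        using elim j dist_triangle[of "(F ^^ n) x" \<xi> "(F ^^ n) j"] by fastforce
    qed
  qed
qed

text \<open>The times \<open>m\<close> merely tend to infinity, because the record times and the
  diagonal times to which this is applied need not be increasing.\<close>

lemma limit_in_boundary:
  assumes z: "z \<in> M" and m: "filterlim m at_top sequentially" and lim: "(\<lambda>i. (F ^^ m i) z) \<longlonglongrightarrow> l"
  shows "l \<in> closure M - M"
proof
  show "l \<in> closure M"
    using z lim funpow_in by (auto simp: closure_sequential intro!: exI[of _ "\<lambda>i. (F ^^ m i) z"])
  show "l \<notin> M"
  proof
    assume l: "l \<in> M"
    obtain e L' where L': "0 < e" "compact L'" "L' \<subseteq> M" "\<forall>x\<in>M. \<forall>q\<in>{l}. d x q < e \<longrightarrow> x \<in> L'"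
      by (rule compact_neighbourhood[of "{l}"]) (use l in auto)
    have "(\<lambda>i. d ((F ^^ m i) z) l) \<longlonglongrightarrow> 0"
      using z l lim funpow_in by (intro d_tendsto) auto
    then have "\<forall>\<^sub>F i in sequentially. d ((F ^^ m i) z) l < e"
      using L'(1) by (intro order_tendstoD(2)[of _ 0]) auto
    moreover have "\<forall>\<^sub>F i in sequentially. (F ^^ m i) z \<notin> L'"
      using divergent[OF z L'(2,3)] m by (rule eventually_compose_filterlim)
    ultimately have "\<forall>\<^sub>F i in sequentially. False"
      by eventually_elim (use L' z funpow_in in auto)
    then show False by simp
  qed
qed

text \<open>
  The image of a curve of length at most \<open>\<kappa>\<close> under \<open>F ^^ n\<close> is again an almost-geodesic for \<open>\<kappa>\<close>,
  yet it leaves every compact set; by visibility its end points cannot approach distinct boundary points.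
\<close>

lemma limit_independent_of_point:
  assumes z: "z \<in> M" and w: "w \<in> M" and m: "filterlim m at_top sequentially"
    and lim: "(\<lambda>i. (F ^^ m i) z) \<longlonglongrightarrow> \<xi>"
  shows "(\<lambda>i. (F ^^ m i) w) \<longlonglongrightarrow> \<xi>"
proof (rule LIMSEQ_if_unique_cluster_point)
  show "compact (closure M)" using bounded by (simp add: compact_closure)
  show "(F ^^ m i) w \<in> closure M" for i using w funpow_in closure_subset by blast
  fix r :: "nat \<Rightarrow> nat" and l
  assume r: "strict_mono r" and l: "(\<lambda>i. (F ^^ m (r i)) w) \<longlonglongrightarrow> l"
  have mr: "filterlim (\<lambda>i. m (r i)) at_top sequentially"
    using m filterlim_subseq[OF r] by (rule filterlim_compose)
  have lim': "(\<lambda>i. (F ^^ m (r i)) z) \<longlonglongrightarrow> \<xi>"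
    using LIMSEQ_subseq_LIMSEQ[OF lim r] by (simp add: o_def)
  show "l = \<xi>"
  proof (rule ccontr)
    assume "l \<noteq> \<xi>"
    then have "z \<noteq> w" using lim' l LIMSEQ_unique by blast
    then obtain a b \<tau> where \<tau>: "\<Gamma> 1 a b \<tau>" "\<tau> a = z" "\<tau> b = w"
      using curve_ex[of z w 1] z w by auto
    \<comment> \<open>The curve comes first and \<open>\<kappa>\<close> is fitted to its length
      afterwards; visibility for this \<open>\<kappa>\<close> supplies one compact set
      \<open>K\<close> for all images of the curve at once.\<close>
    define \<kappa> where "\<kappa> = max 1 (b - a)"
    have \<Gamma>: "\<Gamma> \<kappa> a b (F ^^ n \<circ> \<tau>)" for n
      by (intro curve_funpow curve_mono[OF \<tau>(1)]) (auto simp: \<kappa>_def)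
    have "0 < \<kappa>" by (simp add: \<kappa>_def)
    obtain V W K where VW: "open V" "\<xi> \<in> V" "open W" "l \<in> W" "V \<inter> W = {}" "compact K" "K \<subseteq> M"
      and vis: "\<forall>a b \<tau>. \<Gamma> \<kappa> a b \<tau> \<longrightarrow> \<tau> a \<in> V \<longrightarrow> \<tau> b \<in> W \<longrightarrow> (\<exists>t\<in>{a..b}. \<tau> t \<in> K)"
      by (rule visibleE[OF limit_in_boundary[OF z mr lim'] limit_in_boundary[OF w mr l] \<open>l \<noteq> \<xi>\<close>[symmetric] \<open>0 < \<kappa>\<close>])
    have "\<forall>\<^sub>F i in sequentially. \<forall>x\<in>\<tau> ` {a..b}. (F ^^ m (r i)) x \<notin> K"
      by (rule eventually_compose_filterlim[OF compactly_divergent_iterates[OF curve_compact[OF \<tau>(1)] _ VW(6,7)] mr])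
        (use curve_in[OF \<tau>(1)] in blast)
    moreover have "\<forall>\<^sub>F i in sequentially. (F ^^ m (r i)) z \<in> V"
      using lim' VW by (rule_tac topological_tendstoD)
    moreover have "\<forall>\<^sub>F i in sequentially. (F ^^ m (r i)) w \<in> W"
      using l VW(3,4) by (rule topological_tendstoD)
    ultimately have "\<forall>\<^sub>F i in sequentially. False"
    proof eventually_elim
      case (elim i)
      then show ?case using vis[rule_format, OF \<Gamma>[of "m (r i)"]] \<tau> by auto
    qed
    then show False by simp
  qed
qed

text \<open>
  A curve \<open>\<tau>\<close> joining the two orbits has bounded length, so each of \<open>F ^^ (k * r) \<circ> \<tau>\<close> with \<open>k \<le> N\<close> is an
  almost-geodesic joining neighbourhoods of the two limits and therefore meets the compact set \<open>K\<close>. As the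
  iterates \<open>F\<^sup>l\<close> with \<open>l \<ge> r\<close> move \<open>K\<close> away from itself, the corresponding times are uniformly separated, and there are too many of them.
\<close>

lemma limits_eq_if_bounded_distance:
  assumes z: "z \<in> M" and m: "filterlim m at_top sequentially" and n: "filterlim n at_top sequentially"
    and lim_m: "(\<lambda>i. (F ^^ m i) z) \<longlonglongrightarrow> \<xi>" and lim_n: "(\<lambda>i. (F ^^ n i) z) \<longlonglongrightarrow> \<eta>"
    and bound: "\<And>i. d ((F ^^ m i) z) ((F ^^ n i) z) \<le> B"
  shows "\<xi> = \<eta>"
proof (rule ccontr)
  assume neq: "\<xi> \<noteq> \<eta>"
  have "0 \<le> B" using bound[of 0] d_nonneg z funpow_in by (meson order_trans)
  obtain V W K where VW: "open V" "\<xi> \<in> V" "open W" "\<eta> \<in> W" "V \<inter> W = {}" "compact K" "K \<subseteq> M"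
    and vis: "\<forall>a b \<tau>. \<Gamma> (B + 1) a b \<tau> \<longrightarrow> \<tau> a \<in> V \<longrightarrow> \<tau> b \<in> W \<longrightarrow> (\<exists>t\<in>{a..b}. \<tau> t \<in> K)"
    by (rule visibleE[OF limit_in_boundary[OF z m lim_m] limit_in_boundary[OF z n lim_n] neq, of "B + 1"])
      (use \<open>0 \<le> B\<close> in simp)
  obtain c K' where K': "0 < c" "compact K'" "K' \<subseteq> M" "\<forall>x\<in>M. \<forall>q\<in>K. d x q < c \<longrightarrow> x \<in> K'"
    by (rule compact_neighbourhood[OF VW(6,7)])
  obtain r where r: "\<And>l x. l \<ge> r \<Longrightarrow> x \<in> K \<Longrightarrow> (F ^^ l) x \<notin> K'"
    using compactly_divergent_iterates[OF VW(6,7) K'(2,3)] by (auto simp: eventually_sequentially)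
  \<comment> \<open>Two tolerances are at work. With \<open>B + 1\<close>, which dominates the
    length \<open>b - a \<le> B + \<kappa>\<close>, all images of the joining curve are subject to
    visibility. The curve itself is taken with \<open>\<kappa> \<le> c / 2\<close>, so that points
    at \<open>d\<close>-distance at least \<open>c\<close> have times at least
    \<open>c - \<kappa> \<ge> c / 2\<close> apart.\<close>
  define \<kappa> where "\<kappa> = min 1 (c / 2)"
  have \<kappa>: "0 < \<kappa>" "\<kappa> \<le> 1" "\<kappa> \<le> c / 2" using K'(1) by (auto simp: \<kappa>_def)
  obtain N :: nat where N: "real N * (c / 2) > B + 1"
    using reals_Archimedean3[of "c / 2"] K'(1) by (meson half_gt_zero)
  \<comment> \<open>The extra \<open>k * r\<close> iterations amount to a change of starting point
    and leave both limits as they are; a single \<open>i\<close> can then serve all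
    \<open>k \<le> N\<close>.\<close>
  have "\<forall>\<^sub>F i in sequentially. (F ^^ (k * r + m i)) z \<in> V \<and> (F ^^ (k * r + n i)) z \<in> W" for k
  proof -
    have *: "(F ^^ l) ((F ^^ (k * r)) z) = (F ^^ (k * r + l)) z" for l
      by (metis add.commute comp_apply funpow_add)
    have "(\<lambda>i. (F ^^ (k * r + m i)) z) \<longlonglongrightarrow> \<xi>" "(\<lambda>i. (F ^^ (k * r + n i)) z) \<longlonglongrightarrow> \<eta>"
      using limit_independent_of_point[OF z funpow_in[OF z, of "k * r"] m lim_m]
        limit_independent_of_point[OF z funpow_in[OF z, of "k * r"] n lim_n] by (simp_all only: *)
    then show ?thesis
      using VW(1-4) by (intro eventually_conj) (auto dest: topological_tendstoD)
  qed
  then have "\<forall>\<^sub>F i in sequentially. \<forall>k\<in>{..N}. (F ^^ (k * r + m i)) z \<in> V \<and> (F ^^ (k * r + n i)) z \<in> W"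
    by (intro eventually_ball_finite) auto
  then obtain i where i: "\<And>k. k \<le> N \<Longrightarrow> (F ^^ (k * r + m i)) z \<in> V \<and> (F ^^ (k * r + n i)) z \<in> W"
    by (auto simp: eventually_sequentially)
  have "(F ^^ m i) z \<noteq> (F ^^ n i) z" using i[of 0] VW by auto
  then obtain a b \<tau> where \<tau>: "\<Gamma> \<kappa> a b \<tau>" "\<tau> a = (F ^^ m i) z" "\<tau> b = (F ^^ n i) z"
    using curve_ex[OF funpow_in[OF z] funpow_in[OF z] _ \<kappa>(1)] by blast
  have ab: "a \<le> b" by (rule curve_le[OF \<tau>(1)])
  have "b - a - \<kappa> \<le> B"
    using curve_lower[OF \<tau>(1), of a b] bound[of i] \<tau> ab by auto
  then have len: "b - a \<le> B + 1" using \<kappa> by simp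
  have \<Gamma>: "\<Gamma> (B + 1) a b (F ^^ l \<circ> \<tau>)" for l
    using \<kappa> \<open>0 \<le> B\<close> by (intro curve_funpow curve_mono[OF \<tau>(1)] len) auto
  have "\<exists>t\<in>{a..b}. (F ^^ (k * r)) (\<tau> t) \<in> K" if "k \<le> N" for k
    using vis[rule_format, OF \<Gamma>[of "k * r"]] i[OF that] \<tau> by (auto simp: funpow_add)
  then obtain t where t: "\<And>k. k \<le> N \<Longrightarrow> t k \<in> {a..b}" "\<And>k. k \<le> N \<Longrightarrow> (F ^^ (k * r)) (\<tau> (t k)) \<in> K"
    by metis
  have sep: "c / 2 \<le> \<bar>t j - t k\<bar>" if jk: "j < k" "k \<le> N" for j k
  proof -
    have tau: "\<tau> (t j) \<in> M" "\<tau> (t k) \<in> M" using curve_in[OF \<tau>(1)] t jk by auto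
    have "k * r = (k - j) * r + j * r" using jk by (simp flip: add_mult_distrib)
    then have "(F ^^ (k * r)) (\<tau> (t j)) = (F ^^ ((k - j) * r)) ((F ^^ (j * r)) (\<tau> (t j)))"
      by (simp add: funpow_add)
    moreover have "(k - j) * r \<ge> r" using jk by (simp add: Suc_leI)
    ultimately have "(F ^^ (k * r)) (\<tau> (t j)) \<notin> K'"
      using r t jk by auto
    \<comment> \<open>After \<open>k * r\<close> iterations the point with time \<open>t k\<close>
      is in \<open>K\<close>, whereas the one with time \<open>t j\<close> was in \<open>K\<close>
      after \<open>j * r\<close> iterations and has since left \<open>K'\<close>.\<close>
    then have "c \<le> d ((F ^^ (k * r)) (\<tau> (t j))) ((F ^^ (k * r)) (\<tau> (t k)))"
      using K'(4) t(2)[of k] jk tau funpow_in by (meson not_le)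
    also have "\<dots> \<le> d (\<tau> (t j)) (\<tau> (t k))" using tau by (rule funpow_nonexpansive)
    also have "\<dots> \<le> \<bar>t j - t k\<bar> + \<kappa>" using t jk by (intro curve_upper[OF \<tau>(1)]) auto
    finally show ?thesis using \<kappa> by simp
  qed
  have "real N * (c / 2) \<le> b - a"
    by (rule separated_points_bound[OF t(1) _ sep]) (use K'(1) in auto)
  then show False using N len by simp
qed

section \<open>Convergence of a single orbit\<close>

lemma d_bounded_on_compact:
  assumes "compact K" "K \<subseteq> M" "z \<in> M"
  shows "\<exists>D. \<forall>x\<in>K. d z x \<le> D"
proof -
  obtain J where J: "finite J" "J \<subseteq> K" "\<forall>x\<in>K. \<exists>j\<in>J. d x j < 1"
    by (rule finite_net[of K "\<lambda>x. x" K 1]) (use assms in auto)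
  have "d z x \<le> (\<Sum>j\<in>J. d z j) + 1" if "x \<in> K" for x
  proof -
    obtain j where j: "j \<in> J" "d x j < 1" using J \<open>x \<in> K\<close> by blast
    have "d z x \<le> d z j + d j x" using j J \<open>x \<in> K\<close> assms by (intro d_triangle) auto
    also have "d z j \<le> (\<Sum>j\<in>J. d z j)"
      using j J assms by (intro member_le_sum d_nonneg) auto
    also have "d j x < 1" using j J \<open>x \<in> K\<close> assms d_sym[of j x] by (metis subsetD)
    finally show ?thesis by simp
  qed
  then show ?thesis by blast
qed

lemma orbit_converges:
  assumes z: "z \<in> M"
  shows "\<exists>\<xi>. (\<lambda>n. (F ^^ n) z) \<longlonglongrightarrow> \<xi>"
proof -
  have comp: "compact (closure M)" using bounded by (simp add: compact_closure)
  have cl: "(F ^^ n) z \<in> closure M" for n using z funpow_in closure_subset by blast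
  define a where "a n = d z ((F ^^ n) z)" for n
  have shift: "d ((F ^^ n) z) ((F ^^ (n + k)) z) \<le> a k" for n k
    using funpow_nonexpansive'[OF z, of n 0 k] by (simp add: a_def)
  show ?thesis
  proof (cases "\<exists>B. \<forall>n. a n \<le> B")
    case True
    then obtain B where B: "\<And>n. a n \<le> B" by blast
    obtain \<xi> r where r: "strict_mono (r :: nat \<Rightarrow> nat)" "(\<lambda>i. (F ^^ r i) z) \<longlonglongrightarrow> \<xi>"
      by (rule compact_imp_cluster_point[OF comp cl])
    have "l = \<xi>" if r': "strict_mono r'" "(\<lambda>i. (F ^^ r' i) z) \<longlonglongrightarrow> l" for r' l
    proof (rule limits_eq_if_bounded_distance[OF z filterlim_subseq[OF r'(1)] filterlim_subseq[OF r(1)] r'(2) r(2)])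
      show "d ((F ^^ r' i) z) ((F ^^ r i) z) \<le> 2 * B" for i
        using d_triangle[of "(F ^^ r' i) z" z "(F ^^ r i) z"] B[of "r i"] B[of "r' i"] z funpow_in
          d_sym[of z "(F ^^ r' i) z"] by (auto simp: a_def)
    qed
    then show ?thesis
      using LIMSEQ_if_unique_cluster_point[OF comp, of "\<lambda>n. (F ^^ n) z" \<xi>] cl by blast
  next
    case False
    then obtain \<nu> where \<nu>: "\<And>N. N \<le> \<nu> N" "\<And>N j. j \<le> \<nu> N \<Longrightarrow> a j \<le> a (\<nu> N)"
      using unbounded_records[of a] by metis
    obtain \<xi> r where r: "strict_mono (r :: nat \<Rightarrow> nat)" "(\<lambda>i. (F ^^ \<nu> (r i)) z) \<longlonglongrightarrow> \<xi>"
      by (rule compact_imp_cluster_point[OF comp, of "\<lambda>i. (F ^^ \<nu> i) z"]) (rule cl)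
    define n where "n i = \<nu> (r i)" for i
    have n_ge: "n i \<ge> i" for i
      using \<nu>(1)[of "r i"] strict_mono_imp_increasing[OF r(1), of i] by (simp add: n_def)
    then have n: "filterlim n at_top sequentially"
      by (auto simp: filterlim_at_top eventually_sequentially intro: order_trans)
    have n_lim: "(\<lambda>i. (F ^^ n i) z) \<longlonglongrightarrow> \<xi>" using r by (simp add: n_def)
    have peak: "a j \<le> a (n i)" if "j \<le> n i" for i j using \<nu>(2) that by (simp add: n_def)
    have "\<eta> = \<xi>" if m': "strict_mono m" and m_lim: "(\<lambda>i. (F ^^ m i) z) \<longlonglongrightarrow> \<eta>" for m \<eta>
    proof (rule ccontr)
      assume neq: "\<eta> \<noteq> \<xi>"
      have m: "filterlim m at_top sequentially" using m' by (rule filterlim_subseq)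
      obtain V W K where VW: "open V" "\<eta> \<in> V" "open W" "\<xi> \<in> W" "V \<inter> W = {}" "compact K" "K \<subseteq> M"
        and vis: "\<forall>a b \<tau>. \<Gamma> 1 a b \<tau> \<longrightarrow> \<tau> a \<in> V \<longrightarrow> \<tau> b \<in> W \<longrightarrow> (\<exists>t\<in>{a..b}. \<tau> t \<in> K)"
        by (rule visibleE[OF limit_in_boundary[OF z m m_lim] limit_in_boundary[OF z n n_lim] neq zero_less_one])
      obtain D where D: "\<And>x. x \<in> K \<Longrightarrow> d z x \<le> D"
        using d_bounded_on_compact[OF VW(6,7) z] by blast
      \<comment> \<open>The detour through a point of \<open>K\<close> costs \<open>D\<close> twice;
        the two upper bounds and the lower bound for a curve with \<open>\<kappa> = 1\<close>
        contribute 1 each. The record estimate then cancels \<open>a (n i)\<close>.\<close>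
      have bound: "a (m j) \<le> 2 * D + 3" if Vj: "(F ^^ m j) z \<in> V" for j
      proof -
        have "\<forall>\<^sub>F i in sequentially. (F ^^ n i) z \<in> W"
          using n_lim VW(3,4) by (rule topological_tendstoD)
        moreover have "\<forall>\<^sub>F i in sequentially. m j \<le> n i"
          using n by (simp add: filterlim_at_top)
        ultimately have "\<forall>\<^sub>F i in sequentially. (F ^^ n i) z \<in> W \<and> m j \<le> n i"
          by (rule eventually_conj)
        from eventually_happens'[OF sequentially_bot this] obtain i where i: "(F ^^ n i) z \<in> W" "m j \<le> n i"
          by blast
        have "(F ^^ m j) z \<noteq> (F ^^ n i) z" using i Vj VW(5) by auto
        then obtain p q \<tau> where \<tau>: "\<Gamma> 1 p q \<tau>" "\<tau> p = (F ^^ m j) z" "\<tau> q = (F ^^ n i) z"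
          using curve_ex[OF funpow_in[OF z] funpow_in[OF z] _ zero_less_one] by blast
        have pq: "p \<le> q" by (rule curve_le[OF \<tau>(1)])
        obtain t where t: "t \<in> {p..q}" "\<tau> t \<in> K"
          using vis[rule_format, OF \<tau>(1)] \<tau> Vj i by auto
        have x: "\<tau> t \<in> M" using t VW by auto
        have "d (\<tau> t) ((F ^^ m j) z) \<le> t - p + 1" "d (\<tau> t) ((F ^^ n i) z) \<le> q - t + 1"
          using curve_upper[OF \<tau>(1), of t p] curve_upper[OF \<tau>(1), of t q] t(1) pq unfolding \<tau>(2,3) by auto
        moreover have "q - p - 1 \<le> d ((F ^^ m j) z) ((F ^^ n i) z)"
          using curve_lower[OF \<tau>(1), of p q] pq unfolding \<tau>(2,3) by auto
        \<comment> \<open>Nonexpansiveness bounds the distance by \<open>a (n i - m j)\<close>, and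
          \<open>n i\<close> is a record.\<close>
        moreover have "d ((F ^^ m j) z) ((F ^^ n i) z) \<le> a (n i)"
          using order_trans[OF shift[of "m j" "n i - m j"] peak[of "n i - m j" i]] i(2) by simp
        moreover have "a (m j) \<le> D + d (\<tau> t) ((F ^^ m j) z)" "a (n i) \<le> D + d (\<tau> t) ((F ^^ n i) z)"
          unfolding a_def using d_triangle[OF z x funpow_in[OF z], of "m j"] d_triangle[OF z x funpow_in[OF z], of "n i"]
            D[OF t(2)] by linarith+
        ultimately show ?thesis by linarith
      qed
      \<comment> \<open>The index \<open>j\<close> is chosen only after \<open>i\<close>:
        convergence to \<open>\<eta>\<close> is available in \<open>j\<close> for each fixed
        \<open>i\<close>, without uniformity in \<open>i\<close>.\<close>
      define P where "P i j \<longleftrightarrow> (F ^^ m j) z \<in> V \<and> dist ((F ^^ (n i + m j)) z) \<eta> < 1 / real (Suc i)" for i j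
      have "\<forall>i. \<exists>j. P i j"
      proof
        fix i
        have "(\<lambda>j. (F ^^ m j) ((F ^^ n i) z)) \<longlonglongrightarrow> \<eta>"
          by (rule limit_independent_of_point[OF z funpow_in[OF z] m m_lim])
        then have "(\<lambda>j. (F ^^ (n i + m j)) z) \<longlonglongrightarrow> \<eta>"
          by (simp add: add.commute[of "n i"] funpow_add)
        then have "\<forall>\<^sub>F j in sequentially. dist ((F ^^ (n i + m j)) z) \<eta> < 1 / real (Suc i)"
          by (rule tendstoD) simp
        moreover have "\<forall>\<^sub>F j in sequentially. (F ^^ m j) z \<in> V"
          using m_lim VW(1,2) by (rule topological_tendstoD)
        ultimately have "\<forall>\<^sub>F j in sequentially. (F ^^ m j) z \<in> V \<and> dist ((F ^^ (n i + m j)) z) \<eta> < 1 / real (Suc i)"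
          by (intro eventually_conj)
        from eventually_happens'[OF sequentially_bot this] show "\<exists>j. P i j"
          unfolding P_def .
      qed
      then obtain j where "\<forall>i. P i (j i)" by metis
      then have j: "\<forall>i. (F ^^ m (j i)) z \<in> V \<and> dist ((F ^^ (n i + m (j i))) z) \<eta> < 1 / real (Suc i)"
        unfolding P_def .
      have lim': "(\<lambda>i. (F ^^ (n i + m (j i))) z) \<longlonglongrightarrow> \<eta>"
      proof (rule iffD2[OF tendsto_dist_iff], rule Lim_null_comparison[OF always_eventually LIMSEQ_inverse_real_of_nat], rule allI)
        fix i
        have "dist ((F ^^ (n i + m (j i))) z) \<eta> < 1 / real (Suc i)" using j by blast
        then show "norm (dist ((F ^^ (n i + m (j i))) z) \<eta>) \<le> inverse (real (Suc i))"
          unfolding inverse_eq_divide real_norm_def abs_of_nonneg[OF zero_le_dist] by (rule less_imp_le)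
      qed
      have n': "filterlim (\<lambda>i. n i + m (j i)) at_top sequentially"
        using n by (rule filterlim_at_top_mono) auto
      have "\<xi> = \<eta>"
        by (rule limits_eq_if_bounded_distance[OF z n n' n_lim lim', of "2 * D + 3"])
          (rule order_trans[OF shift bound], use j in blast)
      then show False using neq by simp
    qed
    then show ?thesis
      using LIMSEQ_if_unique_cluster_point[OF comp, of "\<lambda>n. (F ^^ n) z" \<xi>] cl by blast
  qed
qed

theorem iterates_converge:
  assumes "M \<noteq> {}"
  shows "\<exists>\<xi>\<in>closure M - M. (\<forall>z\<in>M. (\<lambda>n. (F ^^ n) z) \<longlonglongrightarrow> \<xi>) \<and>
    (\<forall>K. compact K \<and> K \<subseteq> M \<longrightarrow> uniform_limit K (\<lambda>n. F ^^ n) (\<lambda>_. \<xi>) sequentially)"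
proof -
  obtain z where z: "z \<in> M" using assms by blast
  obtain \<xi> where \<xi>: "(\<lambda>n. (F ^^ n) z) \<longlonglongrightarrow> \<xi>" using orbit_converges[OF z] by blast
  have all: "(\<lambda>n. (F ^^ n) w) \<longlonglongrightarrow> \<xi>" if "w \<in> M" for w
    using limit_independent_of_point[OF z that filterlim_ident \<xi>] .
  show ?thesis
  proof (intro bexI[of _ \<xi>] conjI ballI allI impI)
    show "\<xi> \<in> closure M - M" by (rule limit_in_boundary[OF z filterlim_ident \<xi>])
  qed (use all uniform_limit_iterates in auto)
qed

end

section \<open>Analytic discs and holomorphic maps\<close>

lemma norm_vec_le_sum: "norm (x :: 'a::real_normed_vector^'n) \<le> (\<Sum>i\<in>UNIV. norm (x $ i))"
  unfolding norm_vec_def by (rule L2_set_le_sum) simp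

lemma has_derivative_vec_of_components:
  fixes \<phi> :: "complex \<Rightarrow> complex^'n"
  assumes "\<And>i. ((\<lambda>\<zeta>. \<phi> \<zeta> $ i) has_field_derivative (v $ i)) (at z)"
  shows "(\<phi> has_derivative (\<lambda>h. h *s v)) (at z)"
  unfolding has_derivative_at_within
proof (intro conjI)
  have "linear (\<lambda>h. h *s v)"
    by (rule linearI) (auto simp: vec_eq_iff algebra_simps)
  then show "bounded_linear (\<lambda>h. h *s v)" by (simp add: linear_conv_bounded_linear)
  show "((\<lambda>y. (\<phi> y - \<phi> z - (y - z) *s v) /\<^sub>R norm (y - z)) \<longlongrightarrow> 0) (at z)"
  proof (rule vec_tendstoI)
    fix i
    have "((\<lambda>\<zeta>. \<phi> \<zeta> $ i) has_derivative (\<lambda>h. h * v $ i)) (at z)"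
      using assms[of i] by (simp add: has_field_derivative_def mult_commute_abs)
    then show "((\<lambda>y. ((\<phi> y - \<phi> z - (y - z) *s v) /\<^sub>R norm (y - z)) $ i) \<longlongrightarrow> 0 $ i) (at z)"
      by (simp add: has_derivative_at_within algebra_simps)
  qed
qed

lemma has_derivative_disc:
  fixes \<phi> :: "complex \<Rightarrow> complex^'n"
  assumes "\<And>i. (\<lambda>\<zeta>. \<phi> \<zeta> $ i) holomorphic_on S" "open S" "z \<in> S"
  shows "(\<phi> has_derivative (\<lambda>h. h *s (\<chi> i. deriv (\<lambda>\<zeta>. \<phi> \<zeta> $ i) z))) (at z)"
  by (rule has_derivative_vec_of_components) (use holomorphic_derivI[OF assms(1,2,3)] in auto)

lemma has_field_derivative_comp_matrix:
  fixes \<phi> :: "complex \<Rightarrow> complex^'n" and A :: "complex^'n^'m"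
  assumes "(\<phi> has_derivative (\<lambda>h. h *s v)) (at z)" "(f has_derivative (\<lambda>v. A *v v)) (at (\<phi> z))"
  shows "((\<lambda>\<zeta>. f (\<phi> \<zeta>) $ i) has_field_derivative (A *v v) $ i) (at z)"
proof -
  have "((\<lambda>\<zeta>. f (\<phi> \<zeta>) $ i) has_derivative (\<lambda>h. (A *v (h *s v)) $ i)) (at z)"
    using bounded_linear.has_derivative[OF bounded_linear_vec_nth diff_chain_at[OF assms], of i]
    by (simp add: o_def)
  then show ?thesis
    by (simp add: has_field_derivative_def vector_scalar_commute mult_commute_abs)
qed

lemma holomorphic_comp_components:
  fixes \<phi> :: "complex \<Rightarrow> complex^'n" and f :: "complex^'n \<Rightarrow> complex^'m"
  assumes "holomorphic_map_on U f" "\<And>i. (\<lambda>\<zeta>. \<phi> \<zeta> $ i) holomorphic_on S" "open S" "\<phi> ` S \<subseteq> U"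
  shows "(\<lambda>\<zeta>. f (\<phi> \<zeta>) $ i) holomorphic_on S"
  unfolding holomorphic_on_def
proof
  fix z assume z: "z \<in> S"
  then obtain A :: "complex^'n^'m" where "(f has_derivative (\<lambda>v. A *v v)) (at (\<phi> z))"
    using assms(1,4) unfolding holomorphic_map_on_def by blast
  from has_field_derivative_comp_matrix[OF has_derivative_disc[OF assms(2,3) z] this]
  show "(\<lambda>\<zeta>. f (\<phi> \<zeta>) $ i) field_differentiable at z within S"
    using field_differentiable_def field_differentiable_at_within by blast
qed

text \<open>\<open>F\<close> may be arbitrary off \<open>M\<close>, so only a local ambient
  extension \<open>G\<close> has a derivative. By continuity the disc stays in
  \<open>U \<inter> M\<close> near \<open>z\<close>, where both maps agree.\<close>

lemma disc_comp_has_field_derivative: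
  fixes G :: "complex^'d \<Rightarrow> complex^'m"
  assumes \<phi>: "analytic_disc M \<phi>" and z: "z \<in> ball 0 1" and U: "open U" "\<phi> z \<in> U"
    and G: "(G has_derivative (\<lambda>v. A *v v)) (at (\<phi> z))" and eq: "\<And>x. x \<in> U \<inter> M \<Longrightarrow> F x = G x"
  shows "((\<lambda>\<zeta>. F (\<phi> \<zeta>) $ i) has_field_derivative (A *v (\<chi> i. deriv (\<lambda>\<zeta>. \<phi> \<zeta> $ i) z)) $ i) (at z)"
proof -
  have hol: "\<And>i. (\<lambda>\<zeta>. \<phi> \<zeta> $ i) holomorphic_on ball 0 1" and sub: "\<phi> ` ball 0 1 \<subseteq> M"
    using \<phi> by (auto simp: analytic_disc_def)
  have \<phi>': "(\<phi> has_derivative (\<lambda>h. h *s (\<chi> i. deriv (\<lambda>\<zeta>. \<phi> \<zeta> $ i) z))) (at z)"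
    by (rule has_derivative_disc[OF hol open_ball z])
  have "\<phi> \<midarrow>z\<rightarrow> \<phi> z" using has_derivative_continuous[OF \<phi>'] by (simp add: continuous_at)
  then have "\<forall>\<^sub>F \<zeta> in at z. \<phi> \<zeta> \<in> U" using U by (rule topological_tendstoD)
  then have "\<forall>\<^sub>F \<zeta> in nhds z. \<phi> \<zeta> \<in> U" using U(2) by (simp add: eventually_nhds_conv_at)
  moreover have "\<forall>\<^sub>F \<zeta> in nhds z. \<zeta> \<in> ball 0 1" by (rule eventually_nhds_in_open[OF open_ball z])
  ultimately have "\<forall>\<^sub>F \<zeta> in nhds z. G (\<phi> \<zeta>) $ i = F (\<phi> \<zeta>) $ i"
    by eventually_elim (use eq sub in fastforce)
  from DERIV_cong_ev[OF refl this refl] show ?thesis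
    using has_field_derivative_comp_matrix[OF \<phi>' G, of i] by simp
qed

lemma analytic_disc_comp:
  assumes \<phi>: "analytic_disc M \<phi>" and F: "holomorphic_on_submanifold M F" "F ` M \<subseteq> M"
  shows "analytic_disc M (F \<circ> \<phi>)"
  unfolding analytic_disc_def
proof (intro conjI allI)
  show "(F \<circ> \<phi>) ` ball 0 1 \<subseteq> M" using \<phi> F(2) unfolding analytic_disc_def by fastforce
  fix i
  show "(\<lambda>\<zeta>. (F \<circ> \<phi>) \<zeta> $ i) holomorphic_on ball 0 1"
    unfolding holomorphic_on_def
  proof
    fix z :: complex assume z: "z \<in> ball 0 1"
    then have "\<phi> z \<in> M" using \<phi> by (auto simp: analytic_disc_def)
    then obtain U G where U: "open U" "\<phi> z \<in> U" and G: "holomorphic_map_on U G" and eq: "\<forall>x\<in>U \<inter> M. F x = G x"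
      using F(1) unfolding holomorphic_on_submanifold_def by blast
    obtain A where A: "(G has_derivative (\<lambda>v. A *v v)) (at (\<phi> z))"
      using G U(2) unfolding holomorphic_map_on_def by blast
    show "(\<lambda>\<zeta>. (F \<circ> \<phi>) \<zeta> $ i) field_differentiable at z within ball 0 1"
      using disc_comp_has_field_derivative[OF \<phi> z U A, of F i] eq
      unfolding o_def field_differentiable_def using has_field_derivative_at_within by blast
  qed
qed

lemma analytic_disc_funpow:
  assumes "analytic_disc M \<phi>" "holomorphic_on_submanifold M F" "F ` M \<subseteq> M"
  shows "analytic_disc M (F ^^ n \<circ> \<phi>)"
proof (induction n)
  case (Suc n)
  then show ?case using analytic_disc_comp[OF Suc assms(2,3)] by (simp add: comp_def)
qed (use assms in simp)

text \<open>The scalar Schwarz lemma is applied to each coordinate, scaled by \<open>R\<close>;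
  summing the coordinates costs the factor \<open>CARD('n)\<close>.\<close>

lemma Schwarz_vector:
  fixes \<phi> :: "complex \<Rightarrow> complex^'n"
  assumes hol: "\<And>i. (\<lambda>\<zeta>. \<phi> \<zeta> $ i) holomorphic_on ball 0 1"
    and bound: "\<And>\<zeta>. \<zeta> \<in> ball 0 1 \<Longrightarrow> norm (\<phi> \<zeta> - \<phi> 0) < R" and \<zeta>: "norm \<zeta> < 1"
  shows "norm (\<phi> \<zeta> - \<phi> 0) \<le> real CARD('n) * R * norm \<zeta>"
proof -
  have R: "R > 0" using bound[of 0] by simp
  have "norm ((\<phi> \<zeta> - \<phi> 0) $ i) \<le> R * norm \<zeta>" for i
  proof -
    define h where "h u = (\<phi> u $ i - \<phi> 0 $ i) / of_real R" for u
    have h_zero: "h 0 = 0" by (simp add: h_def)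
    have "norm (h u) < 1" if "norm u < 1" for u
    proof -
      have "norm ((\<phi> u - \<phi> 0) $ i) \<le> norm (\<phi> u - \<phi> 0)" by (rule Finite_Cartesian_Product.norm_nth_le)
      also have "\<dots> < R" using bound that by simp
      finally show ?thesis using R by (simp add: h_def norm_divide)
    qed
    moreover have "h holomorphic_on ball 0 1" unfolding h_def using hol R by (intro holomorphic_intros) auto
    ultimately have "norm (h \<zeta>) \<le> norm \<zeta>"
      using \<zeta> by (intro Schwarz_Lemma(1)) (auto simp: h_zero)
    then show ?thesis using R by (simp add: h_def norm_divide field_simps)
  qed
  then have "(\<Sum>i\<in>UNIV. norm ((\<phi> \<zeta> - \<phi> 0) $ i)) \<le> (\<Sum>i\<in>(UNIV :: 'n set). R * norm \<zeta>)"
    by (intro sum_mono) auto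
  then show ?thesis using norm_vec_le_sum[of "\<phi> \<zeta> - \<phi> 0"] by simp
qed

text \<open>Holomorphy is given as mere differentiability, without continuity of the derivative. A
  Lipschitz bound comes instead from the Schwarz lemma on the complex line through two
  points.\<close>

lemma holomorphic_map_Lipschitz_near:
  fixes G :: "complex^'n \<Rightarrow> complex^'m"
  assumes G: "holomorphic_map_on U G" and "open U" "p \<in> U"
  obtains r L where "0 < r" "cball p r \<subseteq> U" "0 \<le> L"
    "\<forall>x\<in>cball p r. \<forall>y\<in>cball p r. norm (G x - G y) \<le> L * norm (x - y)"
proof -
  have "isCont G p"
    using G assms(3) has_derivative_continuous unfolding holomorphic_map_on_def by blast
  then have "\<forall>\<^sub>F x in nhds p. norm (G x - G p) < 1"
    unfolding continuous_at_eps_delta by (auto simp: eventually_nhds_metric dist_norm)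
  moreover have "\<forall>\<^sub>F x in nhds p. x \<in> U" using assms by (simp add: eventually_nhds_in_open)
  ultimately have "\<forall>\<^sub>F x in nhds p. norm (G x - G p) < 1 \<and> x \<in> U" by (rule eventually_conj)
  then obtain \<rho> where \<rho>: "\<rho> > 0" "\<And>x. dist x p < \<rho> \<Longrightarrow> norm (G x - G p) < 1 \<and> x \<in> U"
    by (auto simp: eventually_nhds_metric)
  \<comment> \<open>Two points of \<open>cball p r\<close> are at most \<open>2 * r < s\<close>
    apart, and a disc of radius \<open>s\<close> about either of them stays within
    \<open>s + r < \<rho>\<close> of \<open>p\<close>.\<close>
  define s where "s = \<rho> / 2"
  define r where "r = \<rho> / 8"
  have bound: "norm (G x - G y) \<le> (real CARD('m) * 2 / s) * norm (x - y)"
    if xy: "x \<in> cball p r" "y \<in> cball p r" for x y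
  proof (cases "x = y")
    case False
    define e where "e = norm (x - y)"
    have e: "0 < e" using False by (simp add: e_def)
    have "e \<le> 2 * r"
      using xy dist_triangle2[of x y p] by (simp add: e_def dist_norm norm_minus_commute)
    then have es: "e < s" using \<rho>(1) by (simp add: r_def s_def)
    \<comment> \<open>The affine disc of radius \<open>s\<close> centred at \<open>y\<close> that
      passes through \<open>x\<close> at the parameter \<open>e / s\<close>.\<close>
    define \<phi> where "\<phi> \<zeta> = y + (\<zeta> * of_real (s / e)) *s (x - y)" for \<zeta>
    have norm_smult: "norm (c *s (x - y)) = norm c * e" for c :: complex
      by (simp add: e_def norm_vec_def norm_mult L2_set_right_distrib flip: right_diff_distrib)
    have \<phi>: "dist (\<phi> \<zeta>) p < \<rho>" if "norm \<zeta> < 1" for \<zeta>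
    proof -
      have "norm (\<phi> \<zeta> - y) = norm \<zeta> * s"
        using e \<rho>(1) unfolding \<phi>_def add_diff_cancel_left' norm_smult by (simp add: norm_mult norm_divide s_def)
      also have "\<dots> \<le> s" using that \<rho>(1) by (simp add: s_def mult_left_le_one_le)
      finally have "dist (\<phi> \<zeta>) y \<le> s" by (simp add: dist_norm)
      moreover have "dist y p \<le> r" using xy by (simp add: dist_commute)
      ultimately have "dist (\<phi> \<zeta>) p \<le> s + r" using dist_triangle[of "\<phi> \<zeta>" p y] by linarith
      then show ?thesis using \<rho>(1) by (simp add: s_def r_def)
    qed
    have hol: "(\<lambda>\<zeta>. (G \<circ> \<phi>) \<zeta> $ i) holomorphic_on ball 0 1" for i
      unfolding o_def
    proof (rule holomorphic_comp_components[OF G])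
      show "(\<lambda>\<zeta>. \<phi> \<zeta> $ i) holomorphic_on ball 0 1" for i
        unfolding \<phi>_def using e by (simp, intro holomorphic_intros) auto
      show "\<phi> ` ball 0 1 \<subseteq> U" using \<phi> \<rho>(2) by auto
    qed auto
    have "norm ((G \<circ> \<phi>) \<zeta> - (G \<circ> \<phi>) 0) < 2" if "\<zeta> \<in> ball 0 1" for \<zeta>
      using \<rho>(2)[OF \<phi>[of \<zeta>]] \<rho>(2)[OF \<phi>[of 0]] that
        norm_triangle_ineq4[of "G (\<phi> \<zeta>) - G p" "G (\<phi> 0) - G p"] by simp
    moreover have "norm (complex_of_real (e / s)) < 1"
      using e es by (simp only: norm_of_real) simp
    ultimately have "norm ((G \<circ> \<phi>) (of_real (e / s)) - (G \<circ> \<phi>) 0) \<le> real CARD('m) * 2 * norm (complex_of_real (e / s))"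
      by (intro Schwarz_vector hol) auto
    moreover have "\<phi> 0 = y" by (simp add: \<phi>_def vec_eq_iff)
    moreover have "complex_of_real (e / s) * of_real (s / e) = 1"
      using e es by (simp flip: of_real_mult)
    then have "\<phi> (of_real (e / s)) = x" unfolding \<phi>_def by (simp only:) (simp add: vec_eq_iff)
    moreover have "norm (complex_of_real (e / s)) = e / s" using e es by (simp only: norm_of_real) simp
    ultimately show ?thesis by (simp add: e_def)
  qed simp
  show thesis
  proof (rule that[of r])
    show "cball p r \<subseteq> U" using \<rho> by (auto simp: r_def dist_commute)
    show "\<forall>x\<in>cball p r. \<forall>y\<in>cball p r. norm (G x - G y) \<le> (real CARD('m) * 2 / s) * norm (x - y)"
      using bound by blast
  qed (use \<rho>(1) in \<open>auto simp: r_def s_def\<close>)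
qed

section \<open>Chains of discs and the Kobayashi distance\<close>

text \<open>The inequality \<open>ln u \<le> u - 1\<close> at \<open>u = (1 - x) / (1 + x)\<close>;
  at the reciprocal it yields the upper bound that follows.\<close>

lemma artanh_ge: "0 \<le> x \<Longrightarrow> x < 1 \<Longrightarrow> x / 2 \<le> artanh (x :: real)"
proof -
  assume x: "0 \<le> x" "x < 1"
  have "- ln ((1 + x) / (1 - x)) = ln ((1 - x) / (1 + x))"
    using x by (simp add: ln_div)
  also have "\<dots> \<le> (1 - x) / (1 + x) - 1"
    using x by (intro ln_le_minus_one) auto
  also have "\<dots> = - (2 * x / (1 + x))"
    using x by (simp add: field_simps)
  finally have "x / (1 + x) \<le> artanh x" by (simp add: artanh_def mult.commute)
  moreover have "x / 2 \<le> x / (1 + x)" using x by (intro divide_left_mono) auto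
  ultimately show ?thesis by (rule order_trans[rotated])
qed

lemma artanh_le: "0 \<le> x \<Longrightarrow> x < 1 \<Longrightarrow> artanh (x :: real) \<le> x / (1 - x)"
  using ln_le_minus_one[of "(1 + x) / (1 - x)"] by (simp add: artanh_def field_simps)

lemma poincare_dist_Moebius: "poincare_dist \<zeta> \<omega> = artanh (norm (Moebius_function 0 \<omega> \<zeta>))"
  by (simp add: poincare_dist_def Moebius_function_simple)

lemma poincare_dist_commute: "poincare_dist \<zeta> \<omega> = poincare_dist \<omega> \<zeta>"
proof -
  have "norm (1 - cnj \<omega> * \<zeta>) = norm (1 - cnj \<zeta> * \<omega>)"
    using complex_mod_cnj[of "1 - cnj \<omega> * \<zeta>"] by (simp add: mult.commute)
  then show ?thesis by (simp add: poincare_dist_def norm_divide norm_minus_commute)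
qed

definition disc_link :: "(complex^'d) set \<Rightarrow> complex^'d \<Rightarrow> complex^'d \<Rightarrow> real \<Rightarrow> bool" where
  "disc_link M x y s \<longleftrightarrow> (\<exists>\<phi> \<zeta> \<omega>. analytic_disc M \<phi> \<and> \<zeta> \<in> ball 0 1 \<and> \<omega> \<in> ball 0 1 \<and>
     \<phi> \<zeta> = x \<and> \<phi> \<omega> = y \<and> s = poincare_dist \<zeta> \<omega>)"

lemma disc_linkI:
  "analytic_disc M \<phi> \<Longrightarrow> \<zeta> \<in> ball 0 1 \<Longrightarrow> \<omega> \<in> ball 0 1 \<Longrightarrow> disc_link M (\<phi> \<zeta>) (\<phi> \<omega>) (poincare_dist \<zeta> \<omega>)"
  unfolding disc_link_def by blast

text \<open>Inductive form of the indexed chains in \<open>kobayashi_dist\<close>: concatenation,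
  reversal and images become rule inductions. \<open>refl\<close> is the chain with
  \<open>n = 0\<close>, which is allowed there for every point as well.\<close>

inductive disc_chain :: "(complex^'d) set \<Rightarrow> complex^'d \<Rightarrow> complex^'d \<Rightarrow> real \<Rightarrow> bool" for M where
  refl: "disc_chain M x x 0"
| step: "disc_link M x y s \<Longrightarrow> disc_chain M y z r \<Longrightarrow> disc_chain M x z (s + r)"

lemma disc_chain_if_sequence:
  assumes "\<And>j. j < n \<Longrightarrow> disc_link M (p j) (p (Suc j)) (s j)"
  shows "disc_chain M (p 0) (p n) (\<Sum>j<n. s j)"
  using assms
proof (induction n arbitrary: p s)
  case 0
  then show ?case by (simp add: disc_chain.refl)
next
  case (Suc n)
  have "disc_chain M (p (Suc 0)) (p (Suc n)) (\<Sum>j<n. s (Suc j))"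
    using Suc.IH[of "\<lambda>j. p (Suc j)" "\<lambda>j. s (Suc j)"] Suc.prems by simp
  then show ?case
    using disc_chain.step[OF Suc.prems[of 0]] by (simp add: sum.lessThan_Suc_shift del: sum.lessThan_Suc)
qed

lemma sequence_if_disc_chain:
  assumes "disc_chain M x z r"
  shows "\<exists>(n :: nat) p \<phi> \<zeta> \<omega>. r = (\<Sum>j<n. poincare_dist (\<zeta> j) (\<omega> j)) \<and> p 0 = x \<and> p n = z \<and>
    (\<forall>j<n. analytic_disc M (\<phi> j) \<and> \<zeta> j \<in> ball 0 1 \<and> \<omega> j \<in> ball 0 1 \<and>
       \<phi> j (\<zeta> j) = p j \<and> \<phi> j (\<omega> j) = p (Suc j))"
  using assms
proof (induction rule: disc_chain.induct)
  case (refl x)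
  show ?case by (intro exI[of _ 0] exI[of _ "\<lambda>_. x"]) simp
next
  case (step x y s z r)
  obtain n p \<phi> \<zeta> \<omega> where *: "r = (\<Sum>j<n. poincare_dist (\<zeta> j) (\<omega> j))" "p 0 = y" "p n = z"
    "\<forall>j<n. analytic_disc M (\<phi> j) \<and> \<zeta> j \<in> ball 0 1 \<and> \<omega> j \<in> ball 0 1 \<and>
       \<phi> j (\<zeta> j) = p j \<and> \<phi> j (\<omega> j) = p (Suc j)"
    using step.IH by blast
  obtain \<phi>' \<zeta>' \<omega>' where l: "analytic_disc M \<phi>'" "\<zeta>' \<in> ball 0 1" "\<omega>' \<in> ball 0 1"
    "\<phi>' \<zeta>' = x" "\<phi>' \<omega>' = y" "s = poincare_dist \<zeta>' \<omega>'"
    using step.hyps(1) unfolding disc_link_def by blast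
  have "\<forall>j<Suc n. analytic_disc M (case_nat \<phi>' \<phi> j) \<and> case_nat \<zeta>' \<zeta> j \<in> ball 0 1 \<and> case_nat \<omega>' \<omega> j \<in> ball 0 1 \<and>
       case_nat \<phi>' \<phi> j (case_nat \<zeta>' \<zeta> j) = case_nat x p j \<and> case_nat \<phi>' \<phi> j (case_nat \<omega>' \<omega> j) = case_nat x p (Suc j)"
  proof (intro allI impI)
    fix j assume "j < Suc n"
    then show "analytic_disc M (case_nat \<phi>' \<phi> j) \<and> case_nat \<zeta>' \<zeta> j \<in> ball 0 1 \<and> case_nat \<omega>' \<omega> j \<in> ball 0 1 \<and>
       case_nat \<phi>' \<phi> j (case_nat \<zeta>' \<zeta> j) = case_nat x p j \<and> case_nat \<phi>' \<phi> j (case_nat \<omega>' \<omega> j) = case_nat x p (Suc j)"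
      using * l by (cases j) auto
  qed
  moreover have "s + r = (\<Sum>j<Suc n. poincare_dist (case_nat \<zeta>' \<zeta> j) (case_nat \<omega>' \<omega> j))"
    using * l by (simp add: sum.lessThan_Suc_shift del: sum.lessThan_Suc)
  ultimately show ?case
    using *(3) by (intro exI[of _ "Suc n"] exI[of _ "case_nat x p"] exI[of _ "case_nat \<phi>' \<phi>"]
      exI[of _ "case_nat \<zeta>' \<zeta>"] exI[of _ "case_nat \<omega>' \<omega>"]) simp
qed

lemma kobayashi_dist_eq: "kobayashi_dist M z w = Inf (ereal ` {r. disc_chain M z w r})"
proof -
  have "{ereal (\<Sum>j<n. poincare_dist (\<zeta> j) (\<omega> j)) | (n :: nat) p \<phi> \<zeta> \<omega>.
            p 0 = z \<and> p n = w \<and>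
            (\<forall>j<n. analytic_disc M (\<phi> j) \<and> \<zeta> j \<in> ball 0 1 \<and> \<omega> j \<in> ball 0 1 \<and>
                   \<phi> j (\<zeta> j) = p j \<and> \<phi> j (\<omega> j) = p (Suc j))} = ereal ` {r. disc_chain M z w r}"
    (is "?A = ?B")
  proof
    show "?A \<subseteq> ?B"
    proof
      fix e assume "e \<in> ?A"
      then obtain n :: nat and p \<phi> \<zeta> \<omega> where *: "e = ereal (\<Sum>j<n. poincare_dist (\<zeta> j) (\<omega> j))"
        "p 0 = z" "p n = w" "\<forall>j<n. analytic_disc M (\<phi> j) \<and> \<zeta> j \<in> ball 0 1 \<and> \<omega> j \<in> ball 0 1 \<and>
                   \<phi> j (\<zeta> j) = p j \<and> \<phi> j (\<omega> j) = p (Suc j)"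
        by blast
      then have "disc_link M (p j) (p (Suc j)) (poincare_dist (\<zeta> j) (\<omega> j))" if "j < n" for j
        using that unfolding disc_link_def by blast
      from disc_chain_if_sequence[of n M p "\<lambda>j. poincare_dist (\<zeta> j) (\<omega> j)", OF this] show "e \<in> ?B" using * by auto
    qed
    show "?B \<subseteq> ?A" by (auto dest!: sequence_if_disc_chain) blast
  qed
  then show ?thesis unfolding kobayashi_dist_def by simp
qed

lemma disc_link_sym: "disc_link M x y s \<Longrightarrow> disc_link M y x s"
  unfolding disc_link_def using poincare_dist_commute by blast

lemma disc_link_nonneg: "disc_link M x y s \<Longrightarrow> 0 \<le> s"
proof -
  assume "disc_link M x y s"
  then obtain \<zeta> \<omega> where *: "\<zeta> \<in> ball 0 1" "\<omega> \<in> ball 0 1" "s = poincare_dist \<zeta> \<omega>"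
    unfolding disc_link_def by blast
  then have "0 \<le> norm (Moebius_function 0 \<omega> \<zeta>) / 2" by simp
  also have "\<dots> \<le> artanh (norm (Moebius_function 0 \<omega> \<zeta>))"
    using * by (intro artanh_ge Moebius_function_norm_lt_1) auto
  finally show ?thesis using * by (simp add: poincare_dist_Moebius)
qed

lemma disc_link_in: "disc_link M x y s \<Longrightarrow> x \<in> M \<and> y \<in> M"
  unfolding disc_link_def analytic_disc_def by blast

lemma disc_chain_trans: "disc_chain M x y r \<Longrightarrow> disc_chain M y z s \<Longrightarrow> disc_chain M x z (r + s)"
proof (induction rule: disc_chain.induct)
  case (step x y s z r)
  then show ?case using disc_chain.step[OF step.hyps(1)] by (simp add: add.assoc)
qed simp

lemma disc_chain_link: "disc_link M x y s \<Longrightarrow> disc_chain M x y s"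
  using disc_chain.step[OF _ disc_chain.refl] by fastforce

lemma disc_chain_sym: "disc_chain M x y r \<Longrightarrow> disc_chain M y x r"
proof (induction rule: disc_chain.induct)
  case (step x y s z r)
  then show ?case
    using disc_chain_trans[OF step.IH disc_chain_link[OF disc_link_sym[OF step.hyps(1)]]] by (simp add: add.commute)
qed (rule disc_chain.refl)

lemma disc_chain_nonneg: "disc_chain M x y r \<Longrightarrow> 0 \<le> r"
  by (induction rule: disc_chain.induct) (auto dest: disc_link_nonneg)

lemma disc_chain_image:
  assumes F: "holomorphic_on_submanifold M F" "F ` M \<subseteq> M"
  shows "disc_chain M x y r \<Longrightarrow> disc_chain M (F x) (F y) r"
proof (induction rule: disc_chain.induct)
  case (step x y s z r)
  have "disc_link M (F x) (F y) s"
    using step.hyps(1) analytic_disc_comp[OF _ F] unfolding disc_link_def comp_def by blast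
  then show ?case using step.IH by (rule disc_chain.step)
qed (rule disc_chain.refl)

text \<open>A disc automorphism moves \<open>\<omega>\<close> to 0, and the Schwarz lemma applies
  since values in \<open>M\<close> differ by less than \<open>2 * R\<close>. The other factor 2 is
  the loss in \<open>artanh_ge\<close>.\<close>

lemma disc_link_dist_le:
  fixes M :: "(complex^'d) set"
  assumes R: "\<And>x. x \<in> M \<Longrightarrow> norm x < R" and link: "disc_link M x y s"
  shows "dist x y \<le> real CARD('d) * (4 * R) * s"
proof -
  obtain \<phi> \<zeta> \<omega> where *: "analytic_disc M \<phi>" "\<zeta> \<in> ball 0 1" "\<omega> \<in> ball 0 1"
    "\<phi> \<zeta> = x" "\<phi> \<omega> = y" "s = poincare_dist \<zeta> \<omega>"
    using link unfolding disc_link_def by blast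
  define u where "u = Moebius_function 0 \<omega> \<zeta>"
  define \<psi> where "\<psi> v = \<phi> (Moebius_function 0 (- \<omega>) v)" for v
  have u: "norm u < 1" unfolding u_def using * by (intro Moebius_function_norm_lt_1) auto
  have "R > 0" using R[of x] norm_ge_zero[of x] link disc_link_in by (metis le_less_trans)
  have m: "Moebius_function 0 (- \<omega>) \<in> ball 0 1 \<rightarrow> ball 0 1"
    using * by (auto intro!: Moebius_function_norm_lt_1)
  have in_M: "\<psi> v \<in> M" if "v \<in> ball 0 1" for v
    using *(1) m that unfolding analytic_disc_def \<psi>_def by blast
  have hol: "(\<lambda>v. \<psi> v $ i) holomorphic_on ball 0 1" for i
  proof -
    have "(\<lambda>\<zeta>. \<phi> \<zeta> $ i) holomorphic_on ball 0 1" using *(1) by (simp add: analytic_disc_def)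
    moreover have "Moebius_function 0 (- \<omega>) holomorphic_on ball 0 1"
      using * by (intro Moebius_function_holomorphic) auto
    ultimately show ?thesis
      using holomorphic_on_compose_gen[of "Moebius_function 0 (- \<omega>)" "ball 0 1" "\<lambda>\<zeta>. \<phi> \<zeta> $ i" "ball 0 1"] m
      unfolding \<psi>_def o_def by blast
  qed
  have "norm (\<psi> v - \<psi> 0) < 2 * R" if "v \<in> ball 0 1" for v
    using R[OF in_M[OF that]] R[OF in_M[of 0]] norm_triangle_ineq4[of "\<psi> v" "\<psi> 0"] by simp
  then have "norm (\<psi> u - \<psi> 0) \<le> real CARD('d) * (2 * R) * norm u"
    by (intro Schwarz_vector hol u)
  moreover have "Moebius_function 0 (- \<omega>) u = \<zeta>"
    unfolding u_def using * by (intro Moebius_function_compose) auto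
  then have "\<psi> u = x" using * by (simp add: \<psi>_def)
  moreover have "\<psi> 0 = y" using * by (simp add: \<psi>_def Moebius_function_of_zero)
  ultimately have "dist x y \<le> real CARD('d) * (2 * R) * norm u" by (simp add: dist_norm)
  also have "norm u \<le> 2 * s" using artanh_ge[of "norm u"] u * by (simp add: u_def poincare_dist_Moebius)
  finally show ?thesis using \<open>R > 0\<close> by (simp add: mult_left_mono algebra_simps)
qed

lemma disc_chain_dist_le:
  fixes M :: "(complex^'d) set"
  assumes R: "\<And>x. x \<in> M \<Longrightarrow> norm x < R"
  shows "disc_chain M x y r \<Longrightarrow> dist x y \<le> real CARD('d) * (4 * R) * r"
proof (induction rule: disc_chain.induct)
  case (step x y s z r)
  have "dist x z \<le> dist x y + dist y z" by (rule dist_triangle)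
  also have "dist x y \<le> real CARD('d) * (4 * R) * s" by (rule disc_link_dist_le[OF R step.hyps(1)])
  finally show ?case using step.IH by (simp add: algebra_simps)
qed simp

section \<open>Local structure of embedded submanifolds\<close>

lemma slice_chart:
  fixes M :: "(complex^'d) set"
  assumes M: "embedded_complex_submanifold M" and p: "p \<in> M"
  obtains J :: "'d set" and U V and \<Phi> \<Psi> :: "complex^'d \<Rightarrow> complex^'d"
  where "open U" "p \<in> U" "open V" "homeomorphism U V \<Phi> \<Psi>" "holomorphic_map_on U \<Phi>" "holomorphic_map_on V \<Psi>"
    "\<Phi> ` (U \<inter> M) = V \<inter> {w. \<forall>i\<in>J. w $ i = 0}"
proof -
  from M obtain J :: "'d set" where "\<forall>p\<in>M. \<exists>U V \<Phi> \<Psi>.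
        open U \<and> p \<in> U \<and> open V \<and>
        homeomorphism U V \<Phi> \<Psi> \<and> holomorphic_map_on U \<Phi> \<and> holomorphic_map_on V (\<Psi> :: complex^'d \<Rightarrow> complex^'d) \<and>
        \<Phi> ` (U \<inter> M) = V \<inter> {w. \<forall>i\<in>J. w $ i = 0}"
    unfolding embedded_complex_submanifold_def by (rule exE)
  from bspec[OF this p] show thesis using that by blast
qed

text \<open>In a slice chart \<open>M\<close> is a piece of a linear subspace, which contains the
  complex line through the images of \<open>p\<close> and \<open>y\<close>. A disc of fixed radius
  on that line reaches \<open>y\<close> at a parameter that shrinks with the distance.\<close>

lemma disc_link_small:
  fixes M :: "(complex^'d) set"
  assumes M: "embedded_complex_submanifold M" and p: "p \<in> M" and "0 < e"
  shows "\<exists>\<delta>>0. \<forall>y\<in>M. dist y p < \<delta> \<longrightarrow> (\<exists>s<e. disc_link M y p s)"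
proof -
  obtain J :: "'d set" and U V and \<Phi> \<Psi> :: "complex^'d \<Rightarrow> complex^'d" where UV: "open U" "p \<in> U" "open V" and hom: "homeomorphism U V \<Phi> \<Psi>"
    and hol: "holomorphic_map_on U \<Phi>" "holomorphic_map_on V \<Psi>"
    and slice: "\<Phi> ` (U \<inter> M) = V \<inter> {w. \<forall>i\<in>J. w $ i = 0}"
    by (rule slice_chart[OF M p])
  have inv: "\<And>x. x \<in> U \<Longrightarrow> \<Psi> (\<Phi> x) = x" and im: "\<Phi> ` U = V"
    using hom unfolding homeomorphism_def by auto
  have \<Psi>_M: "\<Psi> w \<in> M" if w: "w \<in> V" "\<forall>i\<in>J. w $ i = 0" for w
  proof -
    have "w \<in> \<Phi> ` (U \<inter> M)" using slice w by blast
    then show ?thesis using inv by auto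
  qed
  have zero: "\<forall>i\<in>J. \<Phi> x $ i = 0" if "x \<in> U \<inter> M" for x
    using slice that by blast
  have "\<Phi> p \<in> V" using im UV by blast
  then obtain r where r: "0 < r" "ball (\<Phi> p) r \<subseteq> V" using UV(3) openE by blast
  \<comment> \<open>The solution of \<open>c / (1 - c) = e\<close>, so that \<open>artanh_le\<close>
    turns a parameter below \<open>c\<close> into a Poincare distance below
    \<open>e\<close>.\<close>
  define c where "c = e / (1 + e)"
  have c: "0 < c" "c < 1" "c / (1 - c) = e" using \<open>0 < e\<close> by (auto simp: c_def field_simps)
  have "isCont \<Phi> p" using hol(1) UV(2) has_derivative_continuous unfolding holomorphic_map_on_def by blast
  then have "\<forall>\<^sub>F x in nhds p. dist (\<Phi> x) (\<Phi> p) < r * c"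
    unfolding continuous_at_eps_delta using r c by (auto simp: eventually_nhds_metric)
  moreover have "\<forall>\<^sub>F x in nhds p. x \<in> U" by (rule eventually_nhds_in_open[OF UV(1,2)])
  ultimately have "\<forall>\<^sub>F x in nhds p. dist (\<Phi> x) (\<Phi> p) < r * c \<and> x \<in> U" by (rule eventually_conj)
  then obtain \<delta> where \<delta>: "0 < \<delta>" "\<And>x. dist x p < \<delta> \<Longrightarrow> dist (\<Phi> x) (\<Phi> p) < r * c \<and> x \<in> U"
    by (auto simp: eventually_nhds_metric)
  have "\<exists>s<e. disc_link M y p s" if y: "y \<in> M" "dist y p < \<delta>" for y
  proof (cases "\<Phi> y = \<Phi> p")
    case True
    then have "y = p" using inv \<delta>(2)[OF y(2)] UV(2) by metis
    moreover have "analytic_disc M (\<lambda>_. p)" using p by (auto simp: analytic_disc_def)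
    then have "disc_link M p p 0"
      using disc_linkI[of M "\<lambda>_. p" 0 0] by (simp add: poincare_dist_def artanh_def)
    ultimately show ?thesis using \<open>0 < e\<close> by blast
  next
    case False
    define l where "l = norm (\<Phi> y - \<Phi> p)"
    have l: "0 < l" "l < r * c" using False \<delta>(2)[OF y(2)] by (auto simp: l_def dist_norm)
    have "l < r" using l(2) mult_strict_left_mono[OF c(2) r(1)] by simp
    have lr: "l / r < c" using l r by (simp add: field_simps)
    \<comment> \<open>Radius \<open>r\<close> about \<open>\<Phi> p\<close>, passing through
      \<open>\<Phi> y\<close> at the parameter \<open>l / r\<close>.\<close>
    define \<phi> where "\<phi> \<zeta> = \<Phi> p + (\<zeta> * of_real (r / l)) *s (\<Phi> y - \<Phi> p)" for \<zeta>
    have norm_smult: "norm (a *s (\<Phi> y - \<Phi> p)) = norm a * l" for a :: complex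
      by (simp add: l_def norm_vec_def norm_mult L2_set_right_distrib flip: right_diff_distrib)
    have \<phi>_V: "\<phi> \<zeta> \<in> V" if "norm \<zeta> < 1" for \<zeta>
    proof -
      have "norm (\<phi> \<zeta> - \<Phi> p) = norm \<zeta> * r"
        using l(1) r(1) unfolding \<phi>_def add_diff_cancel_left' norm_smult by (simp add: norm_mult norm_divide)
      then have "dist (\<Phi> p) (\<phi> \<zeta>) < r" using that r(1) by (simp add: dist_norm norm_minus_commute)
      then show ?thesis using r(2) by auto
    qed
    have \<phi>_J: "\<forall>i\<in>J. \<phi> \<zeta> $ i = 0" for \<zeta>
      using zero[of p] zero[of y] p y UV(2) \<delta>(2)[OF y(2)] by (simp add: \<phi>_def)
    have disc: "analytic_disc M (\<Psi> \<circ> \<phi>)"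
      unfolding analytic_disc_def
    proof (intro conjI allI)
      show "(\<Psi> \<circ> \<phi>) ` ball 0 1 \<subseteq> M" using \<phi>_V \<phi>_J \<Psi>_M by auto
      fix i
      show "(\<lambda>\<zeta>. (\<Psi> \<circ> \<phi>) \<zeta> $ i) holomorphic_on ball 0 1"
        unfolding o_def
      proof (rule holomorphic_comp_components[OF hol(2)])
        show "(\<lambda>\<zeta>. \<phi> \<zeta> $ i) holomorphic_on ball 0 1" for i
          unfolding \<phi>_def using l(1) by (simp, intro holomorphic_intros) auto
        show "\<phi> ` ball 0 1 \<subseteq> V" using \<phi>_V by auto
      qed auto
    qed
    have "complex_of_real (l / r) * of_real (r / l) = 1"
      using l r by (simp flip: of_real_mult)
    then have 1: "\<phi> (of_real (l / r)) = \<Phi> y" unfolding \<phi>_def by (simp only:) (simp add: vec_eq_iff)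
    have 0: "\<phi> 0 = \<Phi> p" by (simp add: \<phi>_def vec_eq_iff)
    have n: "norm (complex_of_real (l / r)) = l / r" using l r by (simp only: norm_of_real) simp
    have link: "disc_link M y p (poincare_dist (of_real (l / r)) 0)"
    proof -
      have "complex_of_real (l / r) \<in> ball 0 1" unfolding mem_ball_0 n using lr c by linarith
      from disc_linkI[OF disc this, of 0]
      have "disc_link M (\<Psi> (\<phi> (of_real (l / r)))) (\<Psi> (\<phi> 0)) (poincare_dist (of_real (l / r)) 0)" by simp
      moreover have "\<Psi> (\<phi> (of_real (l / r))) = y" unfolding 1 using inv \<delta>(2)[OF y(2)] by blast
      moreover have "\<Psi> (\<phi> 0) = p" unfolding 0 using inv UV(2) by blast
      ultimately show ?thesis by (simp only:)
    qed
    have "poincare_dist (of_real (l / r)) 0 = artanh (l / r)"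
      unfolding poincare_dist_def using n by simp
    also have "\<dots> \<le> (l / r) / (1 - l / r)" using l(1) r(1) \<open>l < r\<close> by (intro artanh_le) auto
    also have "\<dots> < c / (1 - c)" using l r lr c \<open>l < r\<close> by (intro frac_less) auto
    finally show ?thesis using link c(3) by metis
  qed
  then show ?thesis using \<delta>(1) by blast
qed

text \<open>Each chart domain meets \<open>M\<close> in a relatively closed set, the preimage of a
  closed subspace. On the union \<open>W\<close> of all open sets with this property,
  \<open>M\<close> equals \<open>closure M \<inter> W\<close>, and closed-by-open intersections are
  locally compact.\<close>

lemma locally_compact_embedded_submanifold:
  fixes M :: "(complex^'d) set"
  assumes "embedded_complex_submanifold M"
  shows "locally compact M"
proof -
  define W where "W = \<Union>{U. open U \<and> closedin (top_of_set U) (U \<inter> M)}"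
  have "open W" by (auto simp: W_def)
  have "M \<subseteq> W"
  proof
    fix p assume p: "p \<in> M"
    obtain J :: "'d set" and U V and \<Phi> \<Psi> :: "complex^'d \<Rightarrow> complex^'d" where
      UV: "open U" "p \<in> U" "open V" and hom: "homeomorphism U V \<Phi> \<Psi>"
      and "holomorphic_map_on U \<Phi>" "holomorphic_map_on V \<Psi>"
      and slice: "\<Phi> ` (U \<inter> M) = V \<inter> {w. \<forall>i\<in>J. w $ i = 0}"
      by (rule slice_chart[OF assms p])
    have inv: "\<And>x. x \<in> U \<Longrightarrow> \<Psi> (\<Phi> x) = x" and im: "\<Phi> ` U = V" and cont: "continuous_on U \<Phi>"
      using hom unfolding homeomorphism_def by auto
    have "U \<inter> M = U \<inter> \<Phi> -` {w. \<forall>i\<in>J. w $ i = 0}"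
    proof
      show "U \<inter> M \<subseteq> U \<inter> \<Phi> -` {w. \<forall>i\<in>J. w $ i = 0}" using slice by blast
      show "U \<inter> \<Phi> -` {w. \<forall>i\<in>J. w $ i = 0} \<subseteq> U \<inter> M"
      proof
        fix x assume x: "x \<in> U \<inter> \<Phi> -` {w. \<forall>i\<in>J. w $ i = 0}"
        then have "\<Phi> x \<in> \<Phi> ` (U \<inter> M)" using slice im by blast
        then obtain y where y: "\<Phi> x = \<Phi> y" "y \<in> U \<inter> M" by (rule imageE)
        then have "x = y" using inv[of x] inv[of y] x by simp
        then show "x \<in> U \<inter> M" using y by blast
      qed
    qed
    moreover have "closed {w :: complex^'d. \<forall>i\<in>J. w $ i = 0}"
      unfolding Ball_def by (intro closed_Collect_all closed_Collect_imp closed_Collect_eq open_Collect_const) (auto intro: continuous_intros)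
    ultimately have "closedin (top_of_set U) (U \<inter> M)"
      using continuous_closedin_preimage[OF cont] by (simp only:)
    then show "p \<in> W" using UV by (auto simp: W_def)
  qed
  moreover have "closure M \<inter> W \<subseteq> M"
  proof
    fix x assume x: "x \<in> closure M \<inter> W"
    then obtain U where U: "open U" "x \<in> U" "closedin (top_of_set U) (U \<inter> M)" by (auto simp: W_def)
    then obtain T where T: "closed T" "U \<inter> M = T \<inter> U"
      by (metis closedin_closed Int_commute)
    have "x \<in> closure (U \<inter> M)" using open_Int_closure_subset[OF U(1), of M] U x by blast
    also have "\<dots> \<subseteq> T" using T by (intro closure_minimal) auto
    finally show "x \<in> M" using U T by blast
  qed
  ultimately have "M = closure M \<inter> W" using closure_subset by blast
  then show ?thesis
    using \<open>open W\<close> locally_compact_closed_Int_open by (metis closed_closure)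
qed

text \<open>The discs \<open>F ^^ n \<circ> \<phi>\<close> all send \<open>\<zeta>\<close> into
  \<open>Q\<close>, which rules out compact divergence. By tautness some subsequence converges to a
  disc in \<open>M\<close>; its value at \<open>\<omega>\<close> shows that the orbit of
  \<open>y\<close> has no limit point outside \<open>M\<close>.\<close>

lemma disc_iterates_relatively_compact:
  assumes M: "bounded M" "taut M" and F: "holomorphic_on_submanifold M F" "F ` M \<subseteq> M"
    and link: "disc_link M x y s" and Q: "compact Q" "Q \<subseteq> M" "\<forall>n. (F ^^ n) x \<in> Q"
  shows "\<exists>Q'. compact Q' \<and> Q' \<subseteq> M \<and> (\<forall>n. (F ^^ n) y \<in> Q')"
proof -
  obtain \<phi> \<zeta> \<omega> where \<phi>: "analytic_disc M \<phi>" "\<zeta> \<in> ball 0 1" "\<omega> \<in> ball 0 1" "\<phi> \<zeta> = x" "\<phi> \<omega> = y"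
    using link unfolding disc_link_def by blast
  define S where "S = range (\<lambda>n. (F ^^ n) y)"
  have disc: "analytic_disc M (F ^^ n \<circ> \<phi>)" for n by (rule analytic_disc_funpow[OF \<phi>(1) F])
  then have "S \<subseteq> M" using \<phi>(3,5) unfolding S_def analytic_disc_def by fastforce
  then have "compact (closure S)" using M(1) bounded_subset compact_closure by blast
  moreover have "closure S \<subseteq> M"
  proof
    fix l assume "l \<in> closure S"
    then obtain x' where x': "\<forall>k. x' k \<in> S" "x' \<longlonglongrightarrow> l" by (auto simp: closure_sequential)
    then have "\<forall>k. \<exists>n. x' k = (F ^^ n) y" by (auto simp: S_def)
    then obtain n where n: "\<And>k. x' k = (F ^^ n k) y" by metis
    define f where "f k = F ^^ n k \<circ> \<phi>" for k
    have "\<forall>k. analytic_disc M (f k)" using disc by (simp add: f_def)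
    note taut_f = M(2)[unfolded taut_def, THEN spec, THEN mp, OF this]
    obtain r where r: "strict_mono (r :: nat \<Rightarrow> nat)" and cases:
      "(\<exists>g. analytic_disc M g \<and> (\<forall>K. compact K \<and> K \<subseteq> ball 0 1 \<longrightarrow> uniform_limit K (f \<circ> r) g sequentially)) \<or>
       compactly_divergent M (f \<circ> r)"
      using taut_f by (elim exE conjE) (rule that)
    have "\<not> compactly_divergent M (f \<circ> r)"
    proof
      assume cd: "compactly_divergent M (f \<circ> r)"
      have "\<forall>\<^sub>F k in sequentially. (f \<circ> r) k ` {\<zeta>} \<inter> Q = {}"
        by (rule cd[unfolded compactly_divergent_def, THEN spec[of _ "{\<zeta>}"], THEN spec[of _ Q], THEN mp])
          (use \<phi>(2) Q(1,2) in simp)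
      then have "\<forall>\<^sub>F k in sequentially. False"
        by eventually_elim (use Q(3) \<phi>(4) in \<open>auto simp: f_def\<close>)
      then show False by simp
    qed
    then obtain g where g: "analytic_disc M g"
      "\<forall>K. compact K \<and> K \<subseteq> ball 0 1 \<longrightarrow> uniform_limit K (f \<circ> r) g sequentially"
      using cases by blast
    have "uniform_limit {\<omega>} (f \<circ> r) g sequentially"
      by (rule g(2)[THEN spec, THEN mp]) (use \<phi>(3) in simp)
    then have "(\<lambda>k. (f \<circ> r) k \<omega>) \<longlonglongrightarrow> g \<omega>" by (rule tendsto_uniform_limitI) simp
    moreover have "(f \<circ> r) k \<omega> = (x' \<circ> r) k" for k by (simp add: f_def n \<phi>(5))
    ultimately have "l = g \<omega>"
      using LIMSEQ_unique[OF LIMSEQ_subseq_LIMSEQ[OF x'(2) r]] by (simp add: comp_def)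
    then show "l \<in> M" using g(1) \<phi>(3) unfolding analytic_disc_def by blast
  qed
  moreover have "(F ^^ n) y \<in> closure S" for n using closure_subset[of S] by (auto simp: S_def)
  ultimately show ?thesis by blast
qed

lemma chain_iterates_relatively_compact:
  assumes "bounded M" "taut M" "holomorphic_on_submanifold M F" "F ` M \<subseteq> M"
  shows "disc_chain M x y r \<Longrightarrow> \<exists>Q. compact Q \<and> Q \<subseteq> M \<and> (\<forall>n. (F ^^ n) x \<in> Q) \<Longrightarrow>
    \<exists>Q. compact Q \<and> Q \<subseteq> M \<and> (\<forall>n. (F ^^ n) y \<in> Q)"
proof (induction rule: disc_chain.induct)
  case (step x y s z r)
  then show ?case using disc_iterates_relatively_compact[OF assms step.hyps(1)] by blast
qed

section \<open>Images of almost-geodesics\<close>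

lemma absolutely_continuous_imp_continuous_on:
  assumes "absolutely_continuous_curve {a..b} \<sigma>"
  shows "continuous_on {a..b} \<sigma>"
  unfolding continuous_on_iff
proof (intro ballI allI impI)
  fix t \<epsilon> :: real assume t: "t \<in> {a..b}" and "0 < \<epsilon>"
  then obtain \<delta> where \<delta>: "\<delta> > 0" and P: "\<And>P. finite P \<Longrightarrow> \<forall>(s, t)\<in>P. a \<le> s \<and> s \<le> t \<and> t \<le> b \<Longrightarrow>
     pairwise (\<lambda>(s, t) (s', t'). {s<..<t} \<inter> {s'<..<t'} = {}) P \<Longrightarrow>
     (\<Sum>(s, t)\<in>P. t - s) < \<delta> \<Longrightarrow> (\<Sum>(s, t)\<in>P. norm (\<sigma> t - \<sigma> s)) < \<epsilon>"
    using assms[unfolded absolutely_continuous_curve_def, rule_format, OF order_refl \<open>0 < \<epsilon>\<close>] by blast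
  have *: "norm (\<sigma> v - \<sigma> u) < \<epsilon>" if "a \<le> u" "u \<le> v" "v \<le> b" "v - u < \<delta>" for u v
    using P[of "{(u, v)}"] that by simp
  have "dist (\<sigma> s) (\<sigma> t) < \<epsilon>" if "s \<in> {a..b}" "dist s t < \<delta>" for s
    using *[of s t] *[of t s] that t by (cases "s \<le> t") (auto simp: dist_norm norm_minus_commute)
  then show "\<exists>d>0. \<forall>x'\<in>{a..b}. dist x' t < d \<longrightarrow> dist (\<sigma> x') (\<sigma> t) < \<epsilon>" using \<delta> by blast
qed

lemma absolutely_continuous_curve_Lipschitz_comp:
  assumes \<sigma>: "absolutely_continuous_curve I \<sigma>" and lip: "L-lipschitz_on (\<sigma> ` I) f"
  shows "absolutely_continuous_curve I (f \<circ> \<sigma>)"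
  unfolding absolutely_continuous_curve_def
proof (intro allI impI)
  fix a b \<epsilon> :: real assume I: "{a..b} \<subseteq> I" and "0 < \<epsilon>"
  have L: "0 \<le> L" using lip by (rule lipschitz_on_nonneg)
  \<comment> \<open>\<open>L + 1\<close> instead of \<open>L\<close> covers the case
    \<open>L = 0\<close>.\<close>
  have "0 < \<epsilon> / (L + 1)" using \<open>0 < \<epsilon>\<close> L by simp
  from \<sigma>[unfolded absolutely_continuous_curve_def, rule_format, OF I this] obtain \<delta> where \<delta>: "\<delta> > 0" and P: "\<forall>P. finite P \<and> (\<forall>(s, t)\<in>P. a \<le> s \<and> s \<le> t \<and> t \<le> b) \<and>
     pairwise (\<lambda>(s, t) (s', t'). {s<..<t} \<inter> {s'<..<t'} = {}) P \<and>
     (\<Sum>(s, t)\<in>P. t - s) < \<delta> \<longrightarrow> (\<Sum>(s, t)\<in>P. norm (\<sigma> t - \<sigma> s)) < \<epsilon> / (L + 1)" by blast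
  have "(\<Sum>(s, t)\<in>P. norm ((f \<circ> \<sigma>) t - (f \<circ> \<sigma>) s)) < \<epsilon>"
    if prem: "finite P \<and> (\<forall>(s, t)\<in>P. a \<le> s \<and> s \<le> t \<and> t \<le> b) \<and>
     pairwise (\<lambda>(s, t) (s', t'). {s<..<t} \<inter> {s'<..<t'} = {}) P \<and> (\<Sum>(s, t)\<in>P. t - s) < \<delta>" for P
  proof -
    have "(\<Sum>(s, t)\<in>P. norm ((f \<circ> \<sigma>) t - (f \<circ> \<sigma>) s)) \<le> (\<Sum>(s, t)\<in>P. L * norm (\<sigma> t - \<sigma> s))"
    proof (rule sum_mono)
      fix x assume "x \<in> P"
      obtain s t where x: "x = (s, t)" by (cases x)
      have "case x of (s, t) \<Rightarrow> a \<le> s \<and> s \<le> t \<and> t \<le> b" using prem \<open>x \<in> P\<close> by blast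
      then have "s \<in> {a..b}" "t \<in> {a..b}" by (auto simp: x)
      then have "s \<in> I" "t \<in> I" using I by blast+
      then show "(case x of (s, t) \<Rightarrow> norm ((f \<circ> \<sigma>) t - (f \<circ> \<sigma>) s)) \<le> (case x of (s, t) \<Rightarrow> L * norm (\<sigma> t - \<sigma> s))"
        using lipschitz_on_normD[OF lip, of "\<sigma> t" "\<sigma> s"] by (simp add: x)
    qed
    also have "\<dots> = L * (\<Sum>(s, t)\<in>P. norm (\<sigma> t - \<sigma> s))"
      by (simp add: sum_distrib_left case_prod_unfold)
    also have "\<dots> \<le> L * (\<epsilon> / (L + 1))"
      using P[rule_format, OF prem] L by (intro mult_left_mono) auto
    also have "\<dots> < \<epsilon>" using L \<open>0 < \<epsilon>\<close> by (simp add: field_simps)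
    finally show ?thesis .
  qed
  then show "\<exists>\<delta>>0. \<forall>P. finite P \<and> (\<forall>(s, t)\<in>P. a \<le> s \<and> s \<le> t \<and> t \<le> b) \<and>
     pairwise (\<lambda>(s, t) (s', t'). {s<..<t} \<inter> {s'<..<t'} = {}) P \<and> (\<Sum>(s, t)\<in>P. t - s) < \<delta> \<longrightarrow>
     (\<Sum>(s, t)\<in>P. norm ((f \<circ> \<sigma>) t - (f \<circ> \<sigma>) s)) < \<epsilon>"
    using \<delta> by blast
qed

text \<open>Local Lipschitz bounds combine to a global one on a compact set. The dummy time set
  \<open>{0}\<close> fits the time-dependent notion \<open>local_lipschitz\<close>.\<close>

lemma holomorphic_on_submanifold_Lipschitz_on_compact:
  fixes F :: "complex^'d \<Rightarrow> complex^'m"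
  assumes F: "holomorphic_on_submanifold M F" and Q: "compact Q" "Q \<subseteq> M"
  shows "\<exists>L. L-lipschitz_on Q F"
proof -
  have "local_lipschitz {0 :: real} Q (\<lambda>_. F)"
    unfolding local_lipschitz_def
  proof (intro ballI)
    fix p and t :: real assume p: "p \<in> Q" and t: "t \<in> {0}"
    from F[unfolded holomorphic_on_submanifold_def, THEN bspec[of _ _ p]] p Q(2)
    obtain U G where U: "open U" "p \<in> U" and G: "holomorphic_map_on U G" and eq: "\<forall>z\<in>U \<inter> M. F z = G z"
      by blast
    obtain r L where rL: "0 < r" "cball p r \<subseteq> U" "0 \<le> L"
      "\<forall>x\<in>cball p r. \<forall>y\<in>cball p r. norm (G x - G y) \<le> L * norm (x - y)"
      by (rule holomorphic_map_Lipschitz_near[OF G U])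
    have "L-lipschitz_on (cball p r \<inter> Q) F"
    proof (rule lipschitz_onI)
      fix x y assume xy: "x \<in> cball p r \<inter> Q" "y \<in> cball p r \<inter> Q"
      then have "F x = G x" "F y = G y" using eq rL(2) Q(2) by blast+
      then show "dist (F x) (F y) \<le> L * dist x y" using rL(4) xy by (simp add: dist_norm)
    qed (rule rL(3))
    then show "\<exists>u>0. \<exists>L. \<forall>t\<in>cball t u \<inter> {0}. L-lipschitz_on (cball p u \<inter> Q) F"
      using rL(1) by blast
  qed
  then obtain L where "\<And>t :: real. t \<in> {0} \<Longrightarrow> L-lipschitz_on Q F"
    by (rule local_lipschitz_compact_implies_lipschitz) (use Q in auto)
  then show ?thesis by blast
qed

text \<open>Composing with \<open>F\<close> turns each disc competing for \<open>v\<close> into one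
  competing for \<open>A *v v\<close> with the same \<open>t\<close>. The matrix \<open>A\<close>
  may depend on the extension \<open>G\<close>, but for \<open>v\<close> without competing discs the
  right-hand side is infinite.\<close>

lemma kobayashi_metric_image_le:
  fixes F G :: "complex^'d \<Rightarrow> complex^'d"
  assumes F: "holomorphic_on_submanifold M F" "F ` M \<subseteq> M"
    and U: "open U" "z \<in> U" and G: "(G has_derivative (\<lambda>v. A *v v)) (at z)"
    and eq: "\<And>x. x \<in> U \<inter> M \<Longrightarrow> F x = G x"
  shows "kobayashi_metric M (F z) (A *v v) \<le> kobayashi_metric M z v"
  unfolding kobayashi_metric_def
proof (rule Inf_superset_mono, rule subsetI)
  fix e assume "e \<in> {ereal t |t. 0 < t \<and> (\<exists>\<phi>. analytic_disc M \<phi> \<and> \<phi> 0 = z \<and> t *\<^sub>R (\<chi> i. deriv (\<lambda>\<zeta>. \<phi> \<zeta> $ i) 0) = v)}"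
  then obtain t \<phi> where t: "e = ereal t" "0 < t" and \<phi>: "analytic_disc M \<phi>" "\<phi> 0 = z"
    "t *\<^sub>R (\<chi> i. deriv (\<lambda>\<zeta>. \<phi> \<zeta> $ i) 0) = v" by blast
  let ?D = "\<chi> i. deriv (\<lambda>\<zeta>. \<phi> \<zeta> $ i) 0"
  have "((\<lambda>\<zeta>. F (\<phi> \<zeta>) $ i) has_field_derivative (A *v ?D) $ i) (at 0)" for i
    by (rule disc_comp_has_field_derivative[OF \<phi>(1), where U = U and G = G]) (use U G eq \<phi>(2) in auto)
  then have "(\<chi> i. deriv (\<lambda>\<zeta>. (F \<circ> \<phi>) \<zeta> $ i) 0) = A *v ?D"
    by (simp add: vec_eq_iff DERIV_imp_deriv)
  moreover have "t *\<^sub>R (A *v ?D) = A *v v"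
    unfolding \<phi>(3)[symmetric] using linear.scaleR[OF has_derivative_linear[OF G]] by metis
  ultimately have "analytic_disc M (F \<circ> \<phi>) \<and> (F \<circ> \<phi>) 0 = F z \<and> t *\<^sub>R (\<chi> i. deriv (\<lambda>\<zeta>. (F \<circ> \<phi>) \<zeta> $ i) 0) = A *v v"
    using analytic_disc_comp[OF \<phi>(1) F] \<phi>(2) by simp
  then show "e \<in> {ereal t |t. 0 < t \<and> (\<exists>\<phi>. analytic_disc M \<phi> \<and> \<phi> 0 = F z \<and> t *\<^sub>R (\<chi> i. deriv (\<lambda>\<zeta>. \<phi> \<zeta> $ i) 0) = A *v v)}"
    using t by blast
qed

lemma kobayashi_dist_image_le:
  assumes "holomorphic_on_submanifold M F" "F ` M \<subseteq> M"
  shows "kobayashi_dist M (F x) (F y) \<le> kobayashi_dist M x y"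
  unfolding kobayashi_dist_eq
  by (rule Inf_superset_mono) (use disc_chain_image[OF assms] in blast)

lemma kobayashi_dist_nonneg: "0 \<le> kobayashi_dist M x y"
  unfolding kobayashi_dist_eq by (rule Inf_greatest) (auto dest: disc_chain_nonneg)

lemma almost_geodesic_mono:
  assumes "almost_geodesic M \<kappa> I \<sigma>" "\<kappa> \<le> \<kappa>'"
  shows "almost_geodesic M \<kappa>' I \<sigma>"
proof -
  have "ereal (\<bar>t - s\<bar> - \<kappa>') \<le> kobayashi_dist M (\<sigma> t) (\<sigma> s) \<and> kobayashi_dist M (\<sigma> t) (\<sigma> s) \<le> ereal (\<bar>t - s\<bar> + \<kappa>')"
    if "s \<in> I" "t \<in> I" for s t
  proof -
    have *: "ereal (\<bar>t - s\<bar> - \<kappa>) \<le> kobayashi_dist M (\<sigma> t) (\<sigma> s)" "kobayashi_dist M (\<sigma> t) (\<sigma> s) \<le> ereal (\<bar>t - s\<bar> + \<kappa>)"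
      using assms(1) that unfolding almost_geodesic_def by auto
    show ?thesis
      using order_trans[OF _ *(1), of "ereal (\<bar>t - s\<bar> - \<kappa>')"] order_trans[OF *(2), of "ereal (\<bar>t - s\<bar> + \<kappa>')"] assms(2)
      by simp
  qed
  then show ?thesis using assms(1) unfolding almost_geodesic_def by blast
qed

text \<open>
  The lower bound in the definition of an almost-geodesic is void for curves of length at most \<open>\<kappa>\<close>.
\<close>

lemma almost_geodesic_image:
  fixes F :: "complex^'d \<Rightarrow> complex^'d"
  assumes F: "holomorphic_on_submanifold M F" "F ` M \<subseteq> M"
    and \<sigma>: "almost_geodesic M \<kappa> {a..b} \<sigma>" and len: "b - a \<le> \<kappa>"
  shows "almost_geodesic M \<kappa> {a..b} (F \<circ> \<sigma>)"
proof -
  have sub: "\<sigma> ` {a..b} \<subseteq> M" and ac: "absolutely_continuous_curve {a..b} \<sigma>"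
    and upper: "\<And>s t. s \<in> {a..b} \<Longrightarrow> t \<in> {a..b} \<Longrightarrow> kobayashi_dist M (\<sigma> t) (\<sigma> s) \<le> ereal (\<bar>t - s\<bar> + \<kappa>)"
    and AE: "AE t in lebesgue_on {a..b}. \<exists>v. (\<sigma> has_vector_derivative v) (at t within {a..b}) \<and> kobayashi_metric M (\<sigma> t) v \<le> 1"
    using \<sigma> unfolding almost_geodesic_def by auto
  have cont: "continuous_on {a..b} \<sigma>" by (rule absolutely_continuous_imp_continuous_on[OF ac])
  have "compact (\<sigma> ` {a..b})" by (intro compact_continuous_image cont) simp
  then obtain L where "L-lipschitz_on (\<sigma> ` {a..b}) F"
    using holomorphic_on_submanifold_Lipschitz_on_compact[OF F(1) _ sub] by blast
  then have ac': "absolutely_continuous_curve {a..b} (F \<circ> \<sigma>)"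
    by (rule absolutely_continuous_curve_Lipschitz_comp[OF ac])
  have bounds: "ereal (\<bar>t - s\<bar> - \<kappa>) \<le> kobayashi_dist M ((F \<circ> \<sigma>) t) ((F \<circ> \<sigma>) s) \<and>
      kobayashi_dist M ((F \<circ> \<sigma>) t) ((F \<circ> \<sigma>) s) \<le> ereal (\<bar>t - s\<bar> + \<kappa>)" if st: "s \<in> {a..b}" "t \<in> {a..b}" for s t
  proof
    have "ereal (\<bar>t - s\<bar> - \<kappa>) \<le> 0" using st len by (simp add: zero_ereal_def abs_le_iff)
    also have "0 \<le> kobayashi_dist M ((F \<circ> \<sigma>) t) ((F \<circ> \<sigma>) s)" by (rule kobayashi_dist_nonneg)
    finally show "ereal (\<bar>t - s\<bar> - \<kappa>) \<le> kobayashi_dist M ((F \<circ> \<sigma>) t) ((F \<circ> \<sigma>) s)" .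
    show "kobayashi_dist M ((F \<circ> \<sigma>) t) ((F \<circ> \<sigma>) s) \<le> ereal (\<bar>t - s\<bar> + \<kappa>)"
      using order_trans[OF kobayashi_dist_image_le[OF F] upper[OF st]] by simp
  qed
  have deriv: "\<exists>v. ((F \<circ> \<sigma>) has_vector_derivative v) (at t within {a..b}) \<and> kobayashi_metric M ((F \<circ> \<sigma>) t) v \<le> 1"
    if t: "t \<in> {a..b}" and ex: "\<exists>v. (\<sigma> has_vector_derivative v) (at t within {a..b}) \<and> kobayashi_metric M (\<sigma> t) v \<le> 1" for t
  proof -
    obtain v where v: "(\<sigma> has_vector_derivative v) (at t within {a..b})" "kobayashi_metric M (\<sigma> t) v \<le> 1"
      using ex by blast
    have "\<sigma> t \<in> M" using sub t by blast
    from F(1)[unfolded holomorphic_on_submanifold_def, THEN bspec, OF this]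
    obtain U G where U: "open U" "\<sigma> t \<in> U" and G: "holomorphic_map_on U G" and eq: "\<forall>z\<in>U \<inter> M. F z = G z"
      by blast
    obtain A where A: "(G has_derivative (\<lambda>v. A *v v)) (at (\<sigma> t))"
      using G U(2) unfolding holomorphic_map_on_def by blast
    \<comment> \<open>The chain rule is available for the extension \<open>G\<close> only;
      continuity of \<open>\<sigma>\<close> keeps the curve in \<open>U\<close> near
      \<open>t\<close>, where \<open>F\<close> may replace \<open>G\<close>.\<close>
    have "((G \<circ> \<sigma>) has_vector_derivative (A *v v)) (at t within {a..b})"
      by (rule vector_derivative_diff_chain_within[OF v(1) has_derivative_at_withinI[OF A]])
    moreover obtain e where e: "0 < e" "ball (\<sigma> t) e \<subseteq> U" using U openE by blast
    obtain \<delta> where \<delta>: "0 < \<delta>" "\<forall>s\<in>{a..b}. dist s t < \<delta> \<longrightarrow> dist (\<sigma> s) (\<sigma> t) < e"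
      using cont[unfolded continuous_on_iff, rule_format, OF t e(1)] by blast
    have "(G \<circ> \<sigma>) s = (F \<circ> \<sigma>) s" if "s \<in> {a..b}" "dist s t < \<delta>" for s
    proof -
      have "\<sigma> s \<in> U" using e(2) \<delta>(2) that by (auto simp: dist_commute subset_iff)
      moreover have "\<sigma> s \<in> M" using sub that(1) by blast
      ultimately show ?thesis using eq by simp
    qed
    ultimately have "((F \<circ> \<sigma>) has_vector_derivative (A *v v)) (at t within {a..b})"
      using has_vector_derivative_transform_within[OF _ \<delta>(1) t] by blast
    moreover have "kobayashi_metric M (F (\<sigma> t)) (A *v v) \<le> kobayashi_metric M (\<sigma> t) v"
      by (rule kobayashi_metric_image_le[OF F U A]) (use eq in blast)
    then have "kobayashi_metric M ((F \<circ> \<sigma>) t) (A *v v) \<le> 1" using v(2) by (simp add: order_trans)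
    ultimately show ?thesis by blast
  qed
  have "AE t in lebesgue_on {a..b}. t \<in> {a..b}" using AE_space[of "lebesgue_on {a..b}"] by simp
  with AE have "AE t in lebesgue_on {a..b}. \<exists>v. ((F \<circ> \<sigma>) has_vector_derivative v) (at t within {a..b}) \<and>
      kobayashi_metric M ((F \<circ> \<sigma>) t) v \<le> 1"
    by eventually_elim (rule deriv)
  moreover have "(F \<circ> \<sigma>) ` {a..b} \<subseteq> M" using sub F(2) unfolding image_comp[symmetric] by blast
  ultimately show ?thesis
    unfolding almost_geodesic_def using ac' bounds by (simp add: is_interval_cc)
qed

section \<open>The Kobayashi distance as a real-valued metric\<close>

text \<open>A real infimum is meaningful only if some chain exists; there it agrees with
  \<open>kobayashi_dist\<close>.\<close>

definition kobayashi_real_dist :: "(complex^'d) set \<Rightarrow> complex^'d \<Rightarrow> complex^'d \<Rightarrow> real" where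
  "kobayashi_real_dist M z w = Inf {r. disc_chain M z w r}"

lemma kobayashi_real_dist_le: "disc_chain M z w r \<Longrightarrow> kobayashi_real_dist M z w \<le> r"
  unfolding kobayashi_real_dist_def
  by (rule cInf_lower) (auto intro!: bdd_belowI[of _ 0] dest: disc_chain_nonneg)

lemma kobayashi_real_dist_ge:
  "disc_chain M z w r \<Longrightarrow> (\<And>r. disc_chain M z w r \<Longrightarrow> c \<le> r) \<Longrightarrow> c \<le> kobayashi_real_dist M z w"
  unfolding kobayashi_real_dist_def by (rule cInf_greatest) auto

lemma kobayashi_dist_eq_real:
  assumes "disc_chain M z w r"
  shows "kobayashi_dist M z w = ereal (kobayashi_real_dist M z w)"
  unfolding kobayashi_dist_eq kobayashi_real_dist_def
  by (rule ereal_Inf'[symmetric]) (use assms in \<open>auto intro!: bdd_belowI[of _ 0] dest: disc_chain_nonneg\<close>)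

text \<open>The upper bound along a joining almost-geodesic makes \<open>kobayashi_dist\<close>
  finite, so its infimum is not taken over the empty set.\<close>

lemma weak_visibility_imp_chain:
  assumes M: "weak_visibility_property M" and zw: "z \<in> M" "w \<in> M"
  shows "\<exists>r. disc_chain M z w r"
proof (cases "z = w")
  case True
  then show ?thesis using disc_chain.refl by blast
next
  case False
  have "visibility_property M 1" using M by (simp add: weak_visibility_property_def)
  then obtain a b \<sigma> where \<sigma>: "a \<le> b" "almost_geodesic M 1 {a..b} \<sigma>" "\<sigma> a = z" "\<sigma> b = w"
    using zw False unfolding visibility_property_def by blast
  have "a \<in> {a..b}" "b \<in> {a..b}" using \<sigma>(1) by auto
  then have "kobayashi_dist M z w \<le> ereal (\<bar>a - b\<bar> + 1)"
    using \<sigma>(2) unfolding almost_geodesic_def \<sigma>(3)[symmetric] \<sigma>(4)[symmetric] by blast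
  then have "{r. disc_chain M z w r} \<noteq> {}"
    unfolding kobayashi_dist_eq by (intro notI) (simp add: top_ereal_def)
  then show ?thesis by blast
qed

lemma nonexpansive_map_kobayashi:
  fixes M :: "(complex^'d) set"
  assumes M: "embedded_complex_submanifold M" "bounded M" "weak_visibility_property M"
    and F: "holomorphic_on_submanifold M F" "F ` M \<subseteq> M"
  shows "\<exists>C. nonexpansive_map M (kobayashi_real_dist M) F C"
proof -
  obtain R where R: "\<And>x. x \<in> M \<Longrightarrow> norm x < R" "0 < R"
    using M(2) unfolding bounded_pos_less by blast
  define C where "C = real CARD('d) * (4 * R)"
  have C: "0 < C" using R(2) by (simp add: C_def)
  note ex = weak_visibility_imp_chain[OF M(3)]
  have sym_le: "kobayashi_real_dist M x y \<le> kobayashi_real_dist M y x" if xy: "x \<in> M" "y \<in> M" for x y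
  proof -
    obtain r where "disc_chain M y x r" using ex xy by blast
    then show ?thesis
      by (rule kobayashi_real_dist_ge) (rule kobayashi_real_dist_le[OF disc_chain_sym])
  qed
  have "nonexpansive_map M (kobayashi_real_dist M) F C"
  proof
    show "locally compact M" by (rule locally_compact_embedded_submanifold[OF M(1)])
    show "0 < C" by (rule C)
    fix x assume x: "x \<in> M"
    show "kobayashi_real_dist M x x = 0"
    proof (rule antisym)
      show "kobayashi_real_dist M x x \<le> 0" by (rule kobayashi_real_dist_le[OF disc_chain.refl])
      show "0 \<le> kobayashi_real_dist M x x"
        by (rule kobayashi_real_dist_ge[OF disc_chain.refl]) (rule disc_chain_nonneg)
    qed
    show "F x \<in> M" using F(2) x by blast
    show "\<exists>\<delta>>0. \<forall>y\<in>M. dist y x < \<delta> \<longrightarrow> kobayashi_real_dist M y x < e" if e: "0 < e" for e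
    proof -
      obtain \<delta> where "0 < \<delta>" and \<delta>: "\<forall>y\<in>M. dist y x < \<delta> \<longrightarrow> (\<exists>s<e. disc_link M y x s)"
        using disc_link_small[OF M(1) x e] by blast
      have "kobayashi_real_dist M y x < e" if "y \<in> M" "dist y x < \<delta>" for y
      proof -
        obtain s where "s < e" "disc_link M y x s" using \<delta> \<open>y \<in> M\<close> \<open>dist y x < \<delta>\<close> by blast
        then show ?thesis using kobayashi_real_dist_le[OF disc_chain_link] by fastforce
      qed
      then show ?thesis using \<open>0 < \<delta>\<close> by blast
    qed
    fix y assume y: "y \<in> M"
    show "kobayashi_real_dist M x y = kobayashi_real_dist M y x"
      using sym_le[OF x y] sym_le[OF y x] by simp
    obtain r where r: "disc_chain M x y r" using ex x y by blast
    have "dist x y / C \<le> kobayashi_real_dist M x y"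
    proof (rule kobayashi_real_dist_ge[OF r])
      fix r assume "disc_chain M x y r"
      from disc_chain_dist_le[OF R(1) this] show "dist x y / C \<le> r"
        using C by (simp add: C_def field_simps)
    qed
    then show "dist x y \<le> C * kobayashi_real_dist M x y" using C by (simp add: field_simps)
    show "kobayashi_real_dist M (F x) (F y) \<le> kobayashi_real_dist M x y"
      by (rule kobayashi_real_dist_ge[OF r]) (rule kobayashi_real_dist_le[OF disc_chain_image[OF F]])
    fix z assume z: "z \<in> M"
    obtain s where s: "disc_chain M y z s" using ex y z by blast
    \<comment> \<open>The two infima are taken one after the other: over chains from
      \<open>x\<close> to \<open>y\<close> with the second chain fixed, then over chains from
      \<open>y\<close> to \<open>z\<close>.\<close>
    have "kobayashi_real_dist M x z - s' \<le> kobayashi_real_dist M x y" if s': "disc_chain M y z s'" for s'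
    proof (rule kobayashi_real_dist_ge[OF r])
      fix r' assume "disc_chain M x y r'"
      from kobayashi_real_dist_le[OF disc_chain_trans[OF this s']]
      show "kobayashi_real_dist M x z - s' \<le> r'" by simp
    qed
    then have "kobayashi_real_dist M x z - kobayashi_real_dist M x y \<le> kobayashi_real_dist M y z"
      by (intro kobayashi_real_dist_ge[OF s]) (simp add: algebra_simps)
    then show "kobayashi_real_dist M x z \<le> kobayashi_real_dist M x y + kobayashi_real_dist M y z" by simp
  qed
  then show ?thesis by blast
qed

lemma relatively_compact_in_iff:
  fixes S :: "'a::t2_space set"
  shows "relatively_compact_in M S \<longleftrightarrow> (\<exists>Q. compact Q \<and> Q \<subseteq> M \<and> S \<subseteq> Q)"
proof
  assume "relatively_compact_in M S"
  then show "\<exists>Q. compact Q \<and> Q \<subseteq> M \<and> S \<subseteq> Q"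
    unfolding relatively_compact_in_def using closure_subset by blast
next
  assume "\<exists>Q. compact Q \<and> Q \<subseteq> M \<and> S \<subseteq> Q"
  then obtain Q where Q: "compact Q" "Q \<subseteq> M" "S \<subseteq> Q" by blast
  have "closure S \<subseteq> Q" using Q by (intro closure_minimal compact_imp_closed)
  then have "M \<inter> closure S = Q \<inter> closure S" using Q(2) by blast
  then show "relatively_compact_in M S"
    unfolding relatively_compact_in_def using Q compact_Int_closed[OF Q(1) closed_closure] by simp
qed

text \<open>That exactly one alternative holds is expressed as the equivalence of the first with the
  negation of the second.\<close>

theorem theorem1p14:
  fixes M :: "(complex^'d) set" and F :: "complex^'d \<Rightarrow> complex^'d"
  assumes "embedded_complex_submanifold M"
    and "connected M"
    and "bounded M"
    and "weak_visibility_property M"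
    and "taut M"
    and "holomorphic_on_submanifold M F"
    and "F ` M \<subseteq> M"
  shows "(\<forall>z\<in>M. relatively_compact_in M {(F ^^ \<nu>) z | \<nu>. 0 < \<nu>}) \<longleftrightarrow>
         \<not> (\<exists>\<xi>\<in>submanifold_boundary M.
              (\<forall>z\<in>M. (\<lambda>\<nu>. (F ^^ \<nu>) z) \<longlonglongrightarrow> \<xi>) \<and>
              (\<forall>K. compact K \<and> K \<subseteq> M \<longrightarrow>
                 uniform_limit K (\<lambda>\<nu>. F ^^ \<nu>) (\<lambda>_. \<xi>) sequentially))"
proof (intro iffI notI)
  assume rc: "\<forall>z\<in>M. relatively_compact_in M {(F ^^ \<nu>) z | \<nu>. 0 < \<nu>}"
  assume "\<exists>\<xi>\<in>submanifold_boundary M.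
              (\<forall>z\<in>M. (\<lambda>\<nu>. (F ^^ \<nu>) z) \<longlonglongrightarrow> \<xi>) \<and>
              (\<forall>K. compact K \<and> K \<subseteq> M \<longrightarrow> uniform_limit K (\<lambda>\<nu>. F ^^ \<nu>) (\<lambda>_. \<xi>) sequentially)"
  then obtain \<xi> where \<xi>: "\<xi> \<in> closure M - M" "\<forall>z\<in>M. (\<lambda>\<nu>. (F ^^ \<nu>) z) \<longlonglongrightarrow> \<xi>"
    unfolding submanifold_boundary_def by blast
  then have "M \<noteq> {}" by auto
  then obtain z where z: "z \<in> M" by blast
  obtain Q where Q: "compact Q" "Q \<subseteq> M" "{(F ^^ \<nu>) z | \<nu>. 0 < \<nu>} \<subseteq> Q"
    using rc z unfolding relatively_compact_in_iff by blast
  \<comment> \<open>\<open>Suc\<close> because the orbit in the statement starts at the first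
    iterate; the shift does not affect the limit.\<close>
  have in_Q: "(F ^^ Suc n) z \<in> Q" for n using Q(3) by blast
  have "(\<lambda>n. (F ^^ Suc n) z) \<longlonglongrightarrow> \<xi>" using \<xi>(2) z LIMSEQ_Suc by blast
  then have "\<xi> \<in> Q" by (rule closed_sequentially[OF compact_imp_closed[OF Q(1)] in_Q])
  then show False using Q(2) \<xi>(1) by blast
next
  assume no_limit: "\<not> (\<exists>\<xi>\<in>submanifold_boundary M.
              (\<forall>z\<in>M. (\<lambda>\<nu>. (F ^^ \<nu>) z) \<longlonglongrightarrow> \<xi>) \<and>
              (\<forall>K. compact K \<and> K \<subseteq> M \<longrightarrow>
                 uniform_limit K (\<lambda>\<nu>. F ^^ \<nu>) (\<lambda>_. \<xi>) sequentially))"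
  show "\<forall>z\<in>M. relatively_compact_in M {(F ^^ \<nu>) z | \<nu>. 0 < \<nu>}"
  proof (rule ccontr)
    assume "\<not> (\<forall>z\<in>M. relatively_compact_in M {(F ^^ \<nu>) z | \<nu>. 0 < \<nu>})"
    then obtain z0 where z0: "z0 \<in> M" "\<not> relatively_compact_in M {(F ^^ \<nu>) z0 | \<nu>. 0 < \<nu>}" by blast
    have no_Q: "\<not> (\<exists>Q. compact Q \<and> Q \<subseteq> M \<and> (\<forall>n. (F ^^ n) z0 \<in> Q))"
      using z0(2) unfolding relatively_compact_in_iff by blast
    obtain C where "nonexpansive_map M (kobayashi_real_dist M) F C"
      using nonexpansive_map_kobayashi[OF assms(1,3,4,6,7)] by blast
    then interpret nonexpansive_map M "kobayashi_real_dist M" F C .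
    note ex = weak_visibility_imp_chain[OF assms(4)]
    have real: "kobayashi_dist M x y = ereal (kobayashi_real_dist M x y)" if "x \<in> M" "y \<in> M" for x y
      using ex[OF that] kobayashi_dist_eq_real by blast
    \<comment> \<open>Infinitely many visits to \<open>K\<close> would give a cluster point in
      \<open>M\<close> and hence a compact set containing the orbit of \<open>z\<close>; a chain of
      discs from \<open>z\<close> to \<open>z0\<close> would transfer this to
      \<open>z0\<close>.\<close>
    have divergent: "\<forall>\<^sub>F n in sequentially. (F ^^ n) z \<notin> K" if z: "z \<in> M" and K: "compact K" "K \<subseteq> M" for z K
    proof (rule ccontr)
      assume not_ev: "\<not> (\<forall>\<^sub>F n in sequentially. (F ^^ n) z \<notin> K)"
      define A where "A = {n. (F ^^ n) z \<in> K}"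
      have "infinite A"
        using not_ev unfolding A_def eventually_sequentially infinite_nat_iff_unbounded_le by auto
      then have enum: "strict_mono (enumerate A)" "\<And>n. enumerate A n \<in> A"
        by (auto simp: strict_mono_enumerate enumerate_in_set)
      then have "\<forall>n. (F ^^ enumerate A n) z \<in> K" by (simp add: A_def)
      with K(1)[unfolded compact_def] obtain y r where y: "y \<in> K" "strict_mono (r :: nat \<Rightarrow> nat)"
        "((\<lambda>n. (F ^^ enumerate A n) z) \<circ> r) \<longlonglongrightarrow> y"
        by meson
      have lim: "(\<lambda>i. (F ^^ (enumerate A \<circ> r) i) z) \<longlonglongrightarrow> y" using y(3) by (simp add: comp_def)
      have "y \<in> M" using y(1) K(2) by blast
      obtain Q where Q: "compact Q" "Q \<subseteq> M" "\<forall>n. (F ^^ n) z \<in> Q"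
        by (rule orbit_relatively_compact[OF z \<open>y \<in> M\<close> strict_mono_o[OF enum(1) y(2)] lim])
      obtain r where "disc_chain M z z0 r" using ex[OF z z0(1)] by blast
      from chain_iterates_relatively_compact[OF assms(3,5,6,7) this] show False
        using Q no_Q by blast
    qed
    have vis: "visibility_property M \<kappa>" if "0 < \<kappa>" for \<kappa>
      using assms(4) that unfolding weak_visibility_property_def by blast
    interpret visibility_dynamics M "kobayashi_real_dist M" F C
      "\<lambda>\<kappa> a b \<tau>. a \<le> b \<and> almost_geodesic M \<kappa> {a..b} \<tau>"
    proof
      show "bounded M" by (rule assms(3))
      show "\<forall>\<^sub>F n in sequentially. (F ^^ n) z \<notin> K" if "z \<in> M" "compact K" "K \<subseteq> M" for z K
        using divergent that .
      fix \<kappa> :: real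
      show "\<exists>a b \<tau>. (a \<le> b \<and> almost_geodesic M \<kappa> {a..b} \<tau>) \<and> \<tau> a = z \<and> \<tau> b = w"
        if zw: "z \<in> M" "w \<in> M" "z \<noteq> w" "0 < \<kappa>" for z w
        using conjunct1[OF vis[OF zw(4), unfolded visibility_property_def], rule_format, OF zw(1-3)]
        unfolding conj_assoc .
      show "\<exists>V W K. open V \<and> p \<in> V \<and> open W \<and> q \<in> W \<and> V \<inter> W = {} \<and> compact K \<and> K \<subseteq> M \<and>
          (\<forall>a b \<tau>. (a \<le> b \<and> almost_geodesic M \<kappa> {a..b} \<tau>) \<and> \<tau> a \<in> V \<and> \<tau> b \<in> W \<longrightarrow> \<tau> ` {a..b} \<inter> K \<noteq> {})"
        if pq: "p \<in> closure M - M" "q \<in> closure M - M" "p \<noteq> q" "0 < \<kappa>" for p q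
      proof -
        from conjunct2[OF vis[OF pq(4), unfolded visibility_property_def submanifold_boundary_def], rule_format, OF pq(1-3)]
        obtain V W K where VWK: "open V" "p \<in> V" "open W" "q \<in> W" "closure V \<inter> closure W = {}"
          "compact K" "K \<subseteq> M" "\<forall>a b \<tau>. a \<le> b \<and> almost_geodesic M \<kappa> {a..b} \<tau> \<and> \<tau> a \<in> V \<and> \<tau> b \<in> W \<longrightarrow>
              \<tau> ` {a..b} \<inter> K \<noteq> {}"
          by (elim exE conjE) (rule that)
        have "V \<inter> W = {}" using VWK(5) closure_subset by blast
        then show ?thesis
          using VWK by (intro exI[of _ V] exI[of _ W] exI[of _ K]) (simp only: simp_thms conj_assoc)
      qed
      fix a b \<tau> assume \<tau>: "a \<le> b \<and> almost_geodesic M \<kappa> {a..b} \<tau>"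
      show "a \<le> b" using \<tau> by blast
      show in_M: "\<tau> t \<in> M" if "t \<in> {a..b}" for t using \<tau> that unfolding almost_geodesic_def by blast
      show "compact (\<tau> ` {a..b})"
        using \<tau> absolutely_continuous_imp_continuous_on unfolding almost_geodesic_def
        by (intro compact_continuous_image) auto
      show "a \<le> b \<and> almost_geodesic M \<kappa>' {a..b} \<tau>" if "\<kappa> \<le> \<kappa>'" for \<kappa>'
        using \<tau> almost_geodesic_mono that by blast
      show "a \<le> b \<and> almost_geodesic M \<kappa> {a..b} (F \<circ> \<tau>)" if "b - a \<le> \<kappa>"
        using \<tau> almost_geodesic_image[OF assms(6,7) _ that] by blast
      fix s t assume st: "s \<in> {a..b}" "t \<in> {a..b}"
      have "ereal (\<bar>s - t\<bar> - \<kappa>) \<le> kobayashi_dist M (\<tau> s) (\<tau> t)" "kobayashi_dist M (\<tau> s) (\<tau> t) \<le> ereal (\<bar>s - t\<bar> + \<kappa>)"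
        using \<tau> st unfolding almost_geodesic_def by blast+
      then show "kobayashi_real_dist M (\<tau> s) (\<tau> t) \<le> \<bar>s - t\<bar> + \<kappa>" "\<bar>s - t\<bar> - \<kappa> \<le> kobayashi_real_dist M (\<tau> s) (\<tau> t)"
        unfolding real[OF in_M[OF st(1)] in_M[OF st(2)]] by simp_all
    qed
    show False
      using iterates_converge no_limit z0(1) unfolding submanifold_boundary_def by blast
  qed
qed

end
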